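(* Let $R=k[x_1,\dots,x_n]$ with $n\geq 3$, and let $(h_0,h_1,\dots,h_s)$ be the Hilbert function of a graded Artinian level algebra $A=R/I$ with socle degree $s$ having the Weak Lefschetz Property. Then (a) the Hilbert function is a strictly unimodal O-sequence $$h_0<h_1<\cdots<h_{r_1(A)}=\cdots=h_{\theta}>\cdots>h_{s-1}>h_s,$$ where $\theta=\min\{t: h_t>h_{t+1}\}$, such that the positive part of the first difference $(h_0,h_1-h_0,h_2-h_1,\dots)$ is an O-sequence; and (b) $h_{d-1}-h_d\leq (n-1)(h_d-h_{d+1})$ for $s\geq d>\theta$ (with $h_{s+1}=0$).
   Context: $k$ is an infinite field of characteristic $0$; $h_i=\dim_k A_i$, $A_s\neq0$, $A_{s+1}=0$. $A$ is level if its socle $\{a\in A: a\mathfrak m=0\}$ ($\mathfrak m$ the maximal homogeneous ideal) is concentrated in a single degree. $A$ has the Weak Lefschetz Property if there is $L\in A_1$ such that each multiplication map $\times L: A_i\to A_{i+1}$, $1\le i\le s-1$, is injective or surjective. An O-sequence is a sequence $(h_0=1,h_1,\dots)$ of nonnegative integers with $h_{i+1}\le h_i^{\langle i\rangle}$ for all $i\ge1$, where if $h_i=\binom{m_i}{i}+\cdots+\binom{m_j}{j}$ ($m_i>\cdots>m_j\ge j\ge1$) then $h_i^{\langle i\rangle}=\binom{m_i+1}{i+1}+\cdots+\binom{m_j+1}{j+1}$. The reduction number $r_1(A)=\min\{\ell:(R/(I+(L)))_{\ell+1}=0\}$ for a general linear form $L$. *)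

theory Defs
  imports "HOL-Library.Poly_Mapping"
begin

text \<open>Polynomials in the variables x_0, x_1, ... over a field 'k: finitely supported maps from
monomials (exponent vectors, nat \<Rightarrow>0 nat) to coefficients.  This type is a commutative ring
with the usual polynomial multiplication.  R = k[x_0,...,x_(n-1)] is the subring of polynomials
involving only the variables with index < n.\<close>

type_synonym 'k mpoly = "(nat \<Rightarrow>\<^sub>0 nat) \<Rightarrow>\<^sub>0 'k"

definition mdeg :: "(nat \<Rightarrow>\<^sub>0 nat) \<Rightarrow> nat" where
  "mdeg m = (\<Sum>i\<in>Poly_Mapping.keys m. Poly_Mapping.lookup m i)"

definition Rpoly :: "nat \<Rightarrow> 'k::comm_ring_1 mpoly set" where
  "Rpoly n = {p. \<forall>m\<in>Poly_Mapping.keys p. Poly_Mapping.keys m \<subseteq> {..<n}}"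

definition homog :: "nat \<Rightarrow> 'k::comm_ring_1 mpoly \<Rightarrow> bool" where
  "homog d p \<longleftrightarrow> (\<forall>m\<in>Poly_Mapping.keys p. mdeg m = d)"

definition Rdeg :: "nat \<Rightarrow> nat \<Rightarrow> 'k::comm_ring_1 mpoly set" where
  "Rdeg n d = {p. p \<in> Rpoly n \<and> homog d p}"

definition hcomp :: "nat \<Rightarrow> 'k::comm_ring_1 mpoly \<Rightarrow> 'k mpoly" where
  "hcomp d p = Poly_Mapping.mapp (\<lambda>m c. if mdeg m = d then c else 0) p"

definition const :: "'k::comm_ring_1 \<Rightarrow> 'k mpoly" where
  "const c = Poly_Mapping.single 0 c"

definition var :: "nat \<Rightarrow> 'k::comm_ring_1 mpoly" where
  "var i = Poly_Mapping.single (Poly_Mapping.single i 1) 1"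

definition linform :: "nat \<Rightarrow> (nat \<Rightarrow> 'k::comm_ring_1) \<Rightarrow> 'k mpoly" where
  "linform n a = (\<Sum>i<n. const (a i) * var i)"

definition peval :: "(nat \<Rightarrow> 'k::comm_ring_1) \<Rightarrow> 'k mpoly \<Rightarrow> 'k" where
  "peval a p = (\<Sum>m\<in>Poly_Mapping.keys p. Poly_Mapping.lookup p m * (\<Prod>i\<in>Poly_Mapping.keys m. a i ^ Poly_Mapping.lookup m i))"

definition hom_ideal :: "nat \<Rightarrow> 'k::comm_ring_1 mpoly set \<Rightarrow> bool" where
  "hom_ideal n I \<longleftrightarrow> I \<subseteq> Rpoly n \<and> 0 \<in> I \<and> (\<forall>p\<in>I. \<forall>q\<in>I. p + q \<in> I)
     \<and> (\<forall>r\<in>Rpoly n. \<forall>p\<in>I. r * p \<in> I) \<and> (\<forall>p\<in>I. \<forall>d. hcomp d p \<in> I)"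

definition indep_mod :: "'k::comm_ring_1 mpoly set \<Rightarrow> 'k mpoly set \<Rightarrow> bool" where
  "indep_mod I S \<longleftrightarrow> finite S \<and>
     (\<forall>c. (\<Sum>s\<in>S. const (c s) * s) \<in> I \<longrightarrow> (\<forall>s\<in>S. c s = 0))"

definition hilb :: "nat \<Rightarrow> 'k::comm_ring_1 mpoly set \<Rightarrow> nat \<Rightarrow> nat" where
  "hilb n I d = Max {card S | S. S \<subseteq> Rdeg n d \<and> indep_mod I S}"

text \<open>Level: the socle {a \<in> A. a m = 0} (m = (x_0,..,x_(n-1))) is concentrated in a single
degree t, i.e. every socle element equals its degree-t component in A.\<close>
definition level :: "nat \<Rightarrow> 'k::comm_ring_1 mpoly set \<Rightarrow> bool" where
  "level n I \<longleftrightarrow> (\<exists>t. \<forall>p\<in>Rpoly n. (\<forall>i<n. var i * p \<in> I) \<longrightarrow> p - hcomp t p \<in> I)"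

definition WLP :: "nat \<Rightarrow> 'k::comm_ring_1 mpoly set \<Rightarrow> nat \<Rightarrow> bool" where
  "WLP n I s \<longleftrightarrow> (\<exists>L\<in>Rdeg n 1. \<forall>i. 1 \<le> i \<and> i \<le> s - 1 \<longrightarrow>
      (\<forall>f\<in>Rdeg n i. L * f \<in> I \<longrightarrow> f \<in> I) \<or>
      (\<forall>g\<in>Rdeg n (Suc i). \<exists>f\<in>Rdeg n i. g - L * f \<in> I))"

definition redn :: "nat \<Rightarrow> 'k::comm_ring_1 mpoly set \<Rightarrow> 'k mpoly \<Rightarrow> nat" where
  "redn n I L = (LEAST l. \<forall>g\<in>Rdeg n (Suc l). \<exists>f\<in>Rpoly n. g - L * f \<in> I)"

text \<open>Reduction number r_1(A): the value of redn at a general linear form, i.e. the value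
taken on a nonempty Zariski-open subset of the coefficient space k^n (the complement of the
zero set of a nonzero polynomial in n variables).\<close>
definition r1 :: "nat \<Rightarrow> 'k::comm_ring_1 mpoly set \<Rightarrow> nat" where
  "r1 n I = (THE r. \<exists>P\<in>Rpoly n. P \<noteq> 0 \<and>
       (\<forall>a. peval a P \<noteq> 0 \<longrightarrow> redn n I (linform n a) = r))"

text \<open>Macaulay's i-binomial representation a = C(m_i,i) + ... + C(m_j,j),
m_i > ... > m_j \<ge> j \<ge> 1, stored as the list [m_i, ..., m_j] (empty list for a = 0).\<close>
definition mac_rep :: "nat \<Rightarrow> nat \<Rightarrow> nat list \<Rightarrow> bool" where
  "mac_rep i a ms \<longleftrightarrow> length ms \<le> i \<and> sorted_wrt (>) ms \<and>
     (\<forall>t<length ms. i - t \<le> ms ! t) \<and> a = (\<Sum>t<length ms. (ms ! t) choose (i - t))"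

definition mac_pow :: "nat \<Rightarrow> nat \<Rightarrow> nat" where
  "mac_pow a i = (THE b. \<exists>ms. mac_rep i a ms \<and>
      b = (\<Sum>t<length ms. (ms ! t + 1) choose (i - t + 1)))"

definition O_seq :: "(nat \<Rightarrow> nat) \<Rightarrow> bool" where
  "O_seq h \<longleftrightarrow> h 0 = 1 \<and> (\<forall>i\<ge>1. h (Suc i) \<le> mac_pow (h i) i)"

end

theory Submission
  imports
    Defs
    "HOL-Library.Multiset"
    "HOL-Computational_Algebra.Polynomial"
    "Jordan_Normal_Form.Determinant"
begin

text \<open>Let \<open>L\<close> be a Lefschetz element, nonzero in \<open>A\<close>. As \<open>A\<close> is standard graded, once
\<open>\<times>L: A_i \<rightarrow> A_(i+1)\<close> is surjective it stays surjective, and before that it is injective. Having rank at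
least \<open>k\<close> is an open condition on \<open>L\<close>, so \<open>r_1(A)\<close> is the least degree in which multiplication by
some linear form is surjective; this gives the shape of \<open>h\<close> up to \<open>\<theta>\<close>, and the positive part of the
first difference is the Hilbert function of \<open>A/LA\<close>. For \<open>d > \<theta>\<close> the kernel \<open>K\<close> of
\<open>\<times>L: A_(d-1) \<rightarrow> A_d\<close> has dimension \<open>h_(d-1) - h_d\<close>. If \<open>x_j\<close> occurs in \<open>L\<close>, multiplication by the
other \<open>n - 1\<close> variables sends \<open>K\<close> to \<open>n - 1\<close> copies of the next kernel, and it is injective because an
element killed by \<open>L\<close> and by these variables lies in the socle. This proves (b), which propagates the
strict inequality \<open>h_\<theta> > h_(\<theta>+1)\<close> down to degree \<open>s\<close>.

Macaulay's bound is proved for the standard monomials of the ideal. Compressing a set \<open>F\<close> of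
monomials makes it stable under exchanging any variable for a fixed variable \<open>x\<close>; then the shadow of
\<open>F\<close> is \<open>F/x\<close>, and the bound follows by induction together with Green's bound for the
monomials of \<open>F\<close> not divisible by \<open>x\<close>.\<close>

section \<open>Macaulay representations\<close>

text \<open>In Macaulay's notation, \<open>mac_up d a\<close> is $a^{\langle d\rangle}$ and \<open>mac_down d a\<close> is
$a_{\langle d\rangle}$, obtained from the \<open>d\<close>-binomial representation of \<open>a\<close> by replacing each
$\binom{m}{i}$ by $\binom{m+1}{i+1}$ and by $\binom{m-1}{i}$. For \<open>d = 0\<close> only \<open>a = 0\<close> is
meaningful.\<close>

definition mac_top :: "nat \<Rightarrow> nat \<Rightarrow> nat" where
  "mac_top d a = (GREATEST m. m choose d \<le> a)"

fun mac_up :: "nat \<Rightarrow> nat \<Rightarrow> nat" where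
  "mac_up 0 a = 0"
| "mac_up (Suc d) a = (Suc (mac_top (Suc d) a) choose Suc (Suc d))
     + mac_up d (a - (mac_top (Suc d) a choose Suc d))"

fun mac_down :: "nat \<Rightarrow> nat \<Rightarrow> nat" where
  "mac_down 0 a = 0"
| "mac_down (Suc d) a = (mac_top (Suc d) a - 1 choose Suc d)
     + mac_down d (a - (mac_top (Suc d) a choose Suc d))"

text \<open>Bounds the \<open>m\<close> with C(m, d+1) at most \<open>a\<close>, so that the
  greatest one in \<open>mac_top\<close> exists.\<close>

lemma choose_Suc_ge: "m \<le> (m choose Suc d) + d"
proof (induction m)
  case (Suc m)
  show ?case
  proof (cases "d \<le> m")
    case True
    then have "1 \<le> m choose d" by (simp add: Suc_le_eq)
    then show ?thesis using Suc by (simp only: binomial_Suc_Suc)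
  qed auto
qed simp

lemma binomial_mono: "m \<le> n \<Longrightarrow> m choose k \<le> n choose k"
  by (induction rule: dec_induct) (auto intro: le_trans[OF _ binomial_right_mono])

lemma mac_top_eqI:
  assumes "m choose Suc d \<le> a" "a < Suc m choose Suc d"
  shows "mac_top (Suc d) a = m"
  unfolding mac_top_def
proof (rule Greatest_equality)
  fix y assume "y choose Suc d \<le> a"
  with assms(2) have "y choose Suc d < Suc m choose Suc d" by linarith
  then show "y \<le> m" using binomial_mono[of "Suc m" y "Suc d"] by (meson leD leI not_less_eq_eq)
qed (fact assms)

text \<open>Greedy step: for the greatest \<open>m\<close> with C(m, d+1) at most \<open>a\<close>,
  Pascal's rule for C(m+1, d+1) leaves a remainder below C(m, d). The boundary case m = d occurs
  only for a = 0.\<close>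

lemma mac_decomp:
  obtains m r where "a = (m choose Suc d) + r" "r < m choose d" "d \<le> m"
proof -
  have ex: "\<exists>m. m choose Suc d \<le> a" by (rule exI[of _ 0]) simp
  have bd: "\<forall>y. y choose Suc d \<le> a \<longrightarrow> y \<le> a + d"
    using choose_Suc_ge by (meson add_le_mono1 le_trans)
  obtain m where m: "m choose Suc d \<le> a" and max: "\<And>y. y choose Suc d \<le> a \<Longrightarrow> y \<le> m"
    using GreatestI_ex_nat[OF ex] Greatest_le_nat bd by (metis (no_types, lifting))
  have "\<not> Suc m choose Suc d \<le> a" using max by fastforce
  then have lt: "a < (m choose Suc d) + (m choose d)" by simp
  show thesis
  proof
    show "a = (m choose Suc d) + (a - (m choose Suc d))" using m by simp
    show "a - (m choose Suc d) < m choose d" using lt m by linarith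
    then show "d \<le> m" by (metis binomial_eq_0 not_less leI not_less_zero)
  qed
qed

lemma mac_up_rec:
  assumes "r < m choose d"
  shows "mac_up (Suc d) ((m choose Suc d) + r) = (Suc m choose Suc (Suc d)) + mac_up d r"
proof -
  have "mac_top (Suc d) ((m choose Suc d) + r) = m"
    by (rule mac_top_eqI) (use assms in auto)
  then show ?thesis by simp
qed

lemma mac_down_rec:
  assumes "r < m choose d"
  shows "mac_down (Suc d) ((m choose Suc d) + r) = (m - 1 choose Suc d) + mac_down d r"
proof -
  have "mac_top (Suc d) ((m choose Suc d) + r) = m"
    by (rule mac_top_eqI) (use assms in auto)
  then show ?thesis by simp
qed

declare mac_up.simps(2) [simp del] mac_down.simps(2) [simp del]

lemma mac_up_0 [simp]: "mac_up d 0 = 0"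
proof (induction d)
  case (Suc d)
  show ?case using mac_up_rec[of 0 d d] Suc by (simp add: binomial_eq_0)
qed simp

lemma mac_down_0 [simp]: "mac_down d 0 = 0"
proof (induction d)
  case (Suc d)
  show ?case using mac_down_rec[of 0 d d] Suc by (simp add: binomial_eq_0)
qed simp

text \<open>The leading entry \<open>k\<close> of \<open>a\<close> is below \<open>m\<close>; the
  bound for the remainder and Pascal's rule then keep the value below C(k+2, d+2).\<close>

lemma mac_up_less:
  assumes "a < m choose d"
  shows "mac_up d a < Suc m choose Suc d"
  using assms
proof (induction d arbitrary: a m)
  case 0 then show ?case by simp
next
  case (Suc d)
  obtain k r where a: "a = (k choose Suc d) + r" "r < k choose d" by (rule mac_decomp)
  have "k < m"
    using a Suc.prems binomial_mono[of m k "Suc d"] by (metis leD leI le_add1 le_trans)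
  then have "Suc (Suc k) choose Suc (Suc d) \<le> Suc m choose Suc (Suc d)"
    by (intro binomial_mono) auto
  moreover have "mac_up d r < Suc k choose Suc d" using Suc.IH a by blast
  ultimately show ?case using a by (simp add: mac_up_rec)
qed

text \<open>For d = m the right side would be 0, which the hypothesis d < m excludes.\<close>

lemma mac_down_less:
  assumes "a < m choose d" "d < m"
  shows "mac_down d a < m - 1 choose d"
  using assms
proof (induction d arbitrary: a m)
  case 0 then show ?case by simp
next
  case (Suc d)
  obtain k r where a: "a = (k choose Suc d) + r" "r < k choose d" "d \<le> k" by (rule mac_decomp)
  have km: "k < m"
    using a Suc.prems binomial_mono[of m k "Suc d"] by (metis leD leI le_add1 le_trans)
  show ?case
  proof (cases "d < k")
    case True
    then have "mac_down d r < k - 1 choose d" using Suc.IH a by blast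
    moreover have "Suc (k - 1) choose Suc d \<le> m - 1 choose Suc d"
      using km True by (intro binomial_mono) auto
    ultimately show ?thesis using a by (simp add: mac_down_rec)
  next
    case False
    then have "a = 0" using a by simp
    then show ?thesis using Suc.prems by simp
  qed
qed

text \<open>The leading entries decide: by \<open>mac_up_less\<close> the lower terms cannot make up
  for a smaller leading entry. Equal entries leave the remainders to compare.\<close>

lemma mac_up_mono: "a \<le> b \<Longrightarrow> mac_up d a \<le> mac_up d b"
proof (induction d arbitrary: a b)
  case (Suc d)
  obtain k r where a: "a = (k choose Suc d) + r" "r < k choose d" "d \<le> k" by (rule mac_decomp)
  obtain l t where b: "b = (l choose Suc d) + t" "t < l choose d" "d \<le> l" by (rule mac_decomp)
  consider "l < k" | "k = l" | "k < l" by linarith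
  then show ?case
  proof cases
    case 1
    then have "Suc l choose Suc d \<le> k choose Suc d" by (intro binomial_mono) auto
    then show ?thesis using a b Suc.prems by simp
  next
    case 2
    then show ?thesis using a b Suc by (simp add: mac_up_rec)
  next
    case 3
    then have "Suc (Suc k) choose Suc (Suc d) \<le> Suc l choose Suc (Suc d)" by (intro binomial_mono) auto
    moreover have "mac_up d r < Suc k choose Suc d" using a by (intro mac_up_less) 
    ultimately show ?thesis using a b by (simp add: mac_up_rec)
  qed
qed simp

lemma mac_down_choose: "d \<le> m \<Longrightarrow> mac_down d (m choose d) = (if d = 0 then 0 else m - 1 choose d)"
  by (cases d) (use mac_down_rec[of 0 m "d - 1"] in auto)

text \<open>Adding one to \<open>a\<close> either stays within the remainder or carries: the
  remainder reaches C(m, d) and the leading entry rises to m + 1.\<close>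

lemma mac_down_Suc_le: "mac_down d (Suc a) \<le> Suc (mac_down d a)"
proof (induction d arbitrary: a)
  case (Suc d)
  obtain m r where a: "a = (m choose Suc d) + r" "r < m choose d" "d \<le> m" by (rule mac_decomp)
  show ?case
  proof (cases "Suc r < m choose d")
    case True
    have "mac_down (Suc d) (Suc a) = (m - 1 choose Suc d) + mac_down d (Suc r)"
      using mac_down_rec[OF True] a by simp
    then show ?thesis using a Suc.IH[of r] by (simp add: mac_down_rec)
  next
    case False
    then have r: "Suc r = m choose d" using a by simp
    have "Suc a = (Suc m choose Suc d) + 0" using a r by simp
    then have dn: "mac_down (Suc d) (Suc a) = m choose Suc d"
      using mac_down_rec[of 0 "Suc m" d] a(3) by (simp del: binomial_Suc_Suc)
    have dna: "mac_down (Suc d) a = (m - 1 choose Suc d) + mac_down d r"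
      using a by (simp add: mac_down_rec)
    show ?thesis
    proof (cases "d = 0 \<or> m = 0")
      case True
      then show ?thesis using dn dna a by auto
    next
      case False
      then obtain m' where m': "m = Suc m'" by (cases m) auto
      \<comment> \<open>The induction hypothesis at the full remainder C(m, d), whose lowered value
        is C(m-1, d).\<close>
      have "m - 1 choose d \<le> Suc (mac_down d r)"
        using Suc.IH[of r] r mac_down_choose[of d m] a False by simp
      then show ?thesis using dn dna m' by simp
    qed
  qed
qed simp

lemma mac_down_add_le: "mac_down d (a + c) \<le> mac_down d a + c"
  by (induction c) (use mac_down_Suc_le le_trans in fastforce)+

text \<open>Both identities hold term by term: C(m, i) + C(m, i+1) = C(m+1, i+1), and lowering and
  raising C(m, i) in either order gives C(m, i+1). By \<open>mac_down_less\<close> and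
  \<open>mac_up_less\<close> the remainders stay small enough for the recursion equations.\<close>

lemma mac_up_down:
  assumes "d = 0 \<Longrightarrow> a = 0"
  shows "a + mac_up d (mac_down d a) = mac_up d a"
    and "mac_down (Suc d) (mac_up d a) = mac_up d (mac_down d a)"
proof -
  have "a + mac_up d (mac_down d a) = mac_up d a
    \<and> mac_down (Suc d) (mac_up d a) = mac_up d (mac_down d a)"
    using assms
  proof (induction d arbitrary: a)
    case 0
    then show ?case using mac_down_0[of "Suc 0"] by simp
  next
    case (Suc d)
    obtain m r where a: "a = (m choose Suc d) + r" "r < m choose d" "d \<le> m" by (rule mac_decomp)
    have IH: "r + mac_up d (mac_down d r) = mac_up d r"
      "mac_down (Suc d) (mac_up d r) = mac_up d (mac_down d r)"
      using Suc.IH[of r] a(2) by (cases d; simp)+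
    show ?case
    proof (cases "d < m")
      case True
      then obtain m' where m': "m = Suc m'" by (cases m) auto
      have "mac_down d r < m' choose d" using mac_down_less[of r m d] a True m' by simp
      moreover have "mac_down (Suc d) a = (m' choose Suc d) + mac_down d r"
        using mac_down_rec[OF a(2)] a(1) m' by simp
      ultimately have ud: "mac_up (Suc d) (mac_down (Suc d) a)
          = (m choose Suc (Suc d)) + mac_up d (mac_down d r)"
        using m' by (simp add: mac_up_rec)
      have "mac_up d r < Suc m choose Suc d" using a by (intro mac_up_less)
      then have du: "mac_down (Suc (Suc d)) (mac_up (Suc d) a)
          = (m choose Suc (Suc d)) + mac_down (Suc d) (mac_up d r)"
        using a mac_down_rec[of "mac_up d r" "Suc m" "Suc d"] by (simp add: mac_up_rec del: binomial_Suc_Suc)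
      show ?thesis using ud du IH a by (simp add: mac_up_rec)
    next
      case False
      then have "a = 0" using a by simp
      then show ?thesis by simp
    qed
  qed
  then show "a + mac_up d (mac_down d a) = mac_up d a"
    and "mac_down (Suc d) (mac_up d a) = mac_up d (mac_down d a)" by auto
qed

text \<open>Here \<open>f\<close> will be the size of the shadow of a stable set and
  \<open>c\<close> the number of monomials of the set prime to \<open>x\<close>. Write
  \<open>mac_up d f\<close> as f + c + e: lowering it gives c + e, and removing \<open>e\<close>
  from the argument costs at most \<open>e\<close>.\<close>

lemma mac_down_bound:
  assumes "c \<le> mac_up d (mac_down d f)" "d = 0 \<Longrightarrow> f = 0"
  shows "c \<le> mac_down (Suc d) (f + c)"
proof -
  obtain e where e: "mac_up d (mac_down d f) = c + e" using assms(1) by (metis le_Suc_ex)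
  have "mac_up d f = (f + c) + e" using mac_up_down(1)[of d f] assms(2) e by simp
  then have "c + e \<le> mac_down (Suc d) (f + c) + e"
    using mac_up_down(2)[of d f] assms(2) e mac_down_add_le[of "Suc d" "f + c" e] by simp
  then show ?thesis by simp
qed

section \<open>Comparison with the binomial representations in \<open>mac_rep\<close>\<close>

lemma mac_rep_Cons_iff:
  "mac_rep (Suc i) a (m # ms) \<longleftrightarrow>
     (\<exists>r. a = (m choose Suc i) + r \<and> mac_rep i r ms \<and> Suc i \<le> m \<and> (\<forall>k\<in>set ms. k < m))"
proof -
  have "(\<Sum>t<length (m # ms). ((m # ms) ! t) choose (Suc i - t))
      = (m choose Suc i) + (\<Sum>t<length ms. (ms ! t) choose (i - t))"
    by (simp only: length_Cons sum.lessThan_Suc_shift) simp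
  moreover have "(\<forall>t<length (m # ms). Suc i - t \<le> (m # ms) ! t)
      \<longleftrightarrow> Suc i \<le> m \<and> (\<forall>t<length ms. i - t \<le> ms ! t)"
    by (simp only: length_Cons All_less_Suc2) simp
  ultimately show ?thesis unfolding mac_rep_def by auto
qed

text \<open>Used for the tail of a representation: the tail is too small to change the greedy
  choice, so the first entry is the greedy one.\<close>

lemma mac_rep_bound: "mac_rep i a ms \<Longrightarrow> (\<forall>k\<in>set ms. k < m) \<Longrightarrow> i \<le> m \<Longrightarrow> a < m choose i"
proof (induction ms arbitrary: i a m)
  case Nil
  then show ?case by (auto simp: mac_rep_def)
next
  case (Cons k ms)
  then obtain j where i: "i = Suc j" by (cases i) (auto simp: mac_rep_def)
  then obtain r where r: "a = (k choose Suc j) + r" "mac_rep j r ms" "Suc j \<le> k" "\<forall>l\<in>set ms. l < k"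
    using Cons.prems(1) mac_rep_Cons_iff by auto
  have "r < k choose j" using Cons.IH r by simp
  moreover have "Suc k choose Suc j \<le> m choose Suc j" using Cons.prems by (intro binomial_mono) auto
  ultimately show ?case using i r by simp
qed

text \<open>All representations have the same raised value, so the definite description in
  \<open>mac_pow\<close> is well defined without comparing the lists themselves.\<close>

lemma mac_rep_sum: "mac_rep i a ms \<Longrightarrow> (\<Sum>t<length ms. (ms ! t + 1) choose (i - t + 1)) = mac_up i a"
proof (induction ms arbitrary: i a)
  case Nil
  then show ?case by (simp add: mac_rep_def)
next
  case (Cons k ms)
  then obtain j where i: "i = Suc j" by (cases i) (auto simp: mac_rep_def)
  then obtain r where r: "a = (k choose Suc j) + r" "mac_rep j r ms" "Suc j \<le> k" "\<forall>l\<in>set ms. l < k"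
    using Cons.prems(1) mac_rep_Cons_iff by auto
  have "r < k choose j" using mac_rep_bound r by simp
  then have "mac_up i a = (Suc k choose Suc (Suc j)) + mac_up j r" using r i mac_up_rec by simp
  moreover have "(\<Sum>t<length (k # ms). ((k # ms) ! t + 1) choose (Suc j - t + 1))
      = (Suc k choose Suc (Suc j)) + (\<Sum>t<length ms. (ms ! t + 1) choose (j - t + 1))"
    by (simp only: length_Cons sum.lessThan_Suc_shift) simp
  ultimately show ?case using Cons.IH[OF r(2)] i by simp
qed

lemma mac_rep_exists: "(i = 0 \<Longrightarrow> a = 0) \<Longrightarrow> a < m choose i \<Longrightarrow> \<exists>ms. mac_rep i a ms \<and> (\<forall>k\<in>set ms. k < m)"
proof (induction i arbitrary: a m)
  case 0
  then show ?case by (intro exI[of _ "[]"]) (simp add: mac_rep_def)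
next
  case (Suc i)
  obtain k r where a: "a = (k choose Suc i) + r" "r < k choose i" "i \<le> k" by (rule mac_decomp)
  have km: "k < m"
    using a Suc.prems binomial_mono[of m k "Suc i"] by (metis leD leI le_add1 le_trans)
  show ?case
  proof (cases "i = k")
    case True
    then have "a = 0" using a by simp
    then show ?thesis by (intro exI[of _ "[]"]) (simp add: mac_rep_def)
  next
    case False
    obtain ms where "mac_rep i r ms" "\<forall>l\<in>set ms. l < k" using Suc.IH[of r k] a(2) by (cases i) auto
    then have "mac_rep (Suc i) a (k # ms)" "\<forall>l\<in>set (k # ms). l < m"
      unfolding mac_rep_Cons_iff using a False km by auto
    then show ?thesis by blast
  qed
qed

lemma mac_pow_eq_mac_up:
  assumes "i \<ge> 1"
  shows "mac_pow a i = mac_up i a"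
proof -
  obtain j where j: "i = Suc j" using assms by (cases i) auto
  \<comment> \<open>A bound on the entries that is large enough: C(a+i+1, i) exceeds
    \<open>a\<close>.\<close>
  have "Suc (a + i) \<le> (Suc (a + i) choose Suc j) + j" by (rule choose_Suc_ge)
  then have "a < Suc (a + i) choose i" using j by simp
  then obtain ms where ms: "mac_rep i a ms" using mac_rep_exists[of i a] assms by auto
  show ?thesis
    unfolding mac_pow_def
  proof (rule the_equality)
    show "\<exists>ms. mac_rep i a ms \<and> mac_up i a = (\<Sum>t<length ms. (ms ! t + 1) choose (i - t + 1))"
      using ms mac_rep_sum by metis
  qed (use mac_rep_sum in metis)
qed

section \<open>Macaulay's bound for sets of multisets\<close>

text \<open>Monomials of degree \<open>d\<close> in \<open>n\<close> variables, as multisets of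
  variable indices; \<open>add_mset\<close> is multiplication by a variable.\<close>

definition msets :: "nat \<Rightarrow> nat \<Rightarrow> nat multiset set" where
  "msets n d = {M. size M = d \<and> set_mset M \<subseteq> {..<n}}"

definition shadow :: "'a multiset set \<Rightarrow> 'a multiset set" where
  "shadow F = {N. \<exists>x. add_mset x N \<in> F}"

definition stable :: "'a \<Rightarrow> 'a multiset set \<Rightarrow> bool" where
  "stable x F \<longleftrightarrow> (\<forall>N y. add_mset y N \<in> F \<longrightarrow> add_mset x N \<in> F)"

lemma finite_msets: "finite (msets n d)"
proof (induction d)
  case 0
  have "msets n 0 \<subseteq> {{#}}" by (auto simp: msets_def)
  then show ?case using finite_subset by blast
next
  case (Suc d)
  have "msets n (Suc d) \<subseteq> (\<Union>x<n. add_mset x ` msets n d)"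
  proof
    fix M assume M: "M \<in> msets n (Suc d)"
    then have "size M = Suc d" by (simp add: msets_def)
    then obtain x N where N: "M = add_mset x N" using size_eq_Suc_imp_eq_union by metis
    then show "M \<in> (\<Union>x<n. add_mset x ` msets n d)" using M by (auto simp: msets_def)
  qed
  moreover have "finite (\<Union>x<n. add_mset x ` msets n d)" using Suc by simp
  ultimately show ?case by (rule finite_subset)
qed

lemma shadow_msets:
  assumes "F \<subseteq> msets n (Suc d)"
  shows "shadow F \<subseteq> msets n d"
proof
  fix N assume "N \<in> shadow F"
  then obtain x where "add_mset x N \<in> F" unfolding shadow_def by blast
  then have "add_mset x N \<in> msets n (Suc d)" using assms by blast
  then show "N \<in> msets n d" by (simp add: msets_def)
qed

lemma finite_shadow: "F \<subseteq> msets n (Suc d) \<Longrightarrow> finite (shadow F)"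
  using shadow_msets finite_msets finite_subset by metis

lemma shadow_stable: "stable x F \<Longrightarrow> shadow F = {N. add_mset x N \<in> F}"
  unfolding shadow_def stable_def by blast

lemma stable_shadow:
  assumes "stable x F"
  shows "stable x (shadow F)"
  unfolding stable_def shadow_stable[OF assms] mem_Collect_eq
proof (intro allI impI)
  fix N y assume "add_mset x (add_mset y N) \<in> F"
  then have "add_mset y (add_mset x N) \<in> F" by (simp only: add_mset_commute)
  then show "add_mset x (add_mset x N) \<in> F" using assms unfolding stable_def by blast
qed

text \<open>Multiplication by \<open>x\<close> maps the shadow bijectively onto the monomials of
  \<open>F\<close> divisible by \<open>x\<close>.\<close>

lemma card_stable:
  assumes "stable x F" "finite F"
  shows "card F = card (shadow F) + card {M \<in> F. x \<notin># M}"
proof -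
  have "add_mset x ` shadow F = {M \<in> F. x \<in># M}"
  proof (intro equalityI subsetI)
    fix M assume M: "M \<in> {M \<in> F. x \<in># M}"
    then have "M = add_mset x (M - {#x#})" by simp
    moreover have "M - {#x#} \<in> shadow F" using M unfolding shadow_def by (metis (mono_tags, lifting) \<open>M = add_mset x (M - {#x#})\<close> mem_Collect_eq)
    ultimately show "M \<in> add_mset x ` shadow F" by (rule image_eqI)
  qed (use shadow_stable[OF assms(1)] in auto)
  moreover have "card (add_mset x ` shadow F) = card (shadow F)"
    by (rule card_image) (simp add: inj_on_def)
  ultimately have 1: "card {M \<in> F. x \<in># M} = card (shadow F)" by (simp only:)
  have 2: "{M \<in> F. x \<in># M} \<union> {M \<in> F. x \<notin># M} = F" by blast
  have "card ({M \<in> F. x \<in># M} \<union> {M \<in> F. x \<notin># M}) = card {M \<in> F. x \<in># M} + card {M \<in> F. x \<notin># M}"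
    by (rule card_Un_disjoint) (use assms(2) in auto)
  then show ?thesis unfolding 1 2 .
qed

text \<open>The maximum of a set of k + 1 numbers is at least \<open>k\<close>; remove it.
  Consequently, compressing a fibre lowers the sum of its exponents unless it is already an initial
  segment.\<close>

lemma sum_lessThan_card_le_aux:
  fixes A :: "nat set"
  assumes "finite A" "card A = k"
  shows "\<Sum>{..<k} \<le> \<Sum>A \<and> (\<Sum>A = \<Sum>{..<k} \<longrightarrow> A = {..<k})"
  using assms
proof (induction k arbitrary: A)
  case (Suc k)
  define m where "m = Max A"
  have fA: "finite A" and cA: "card A = Suc k" by fact+
  then have ne: "A \<noteq> {}" by auto
  have mA: "m \<in> A" "\<And>a. a \<in> A \<Longrightarrow> a \<le> m" using fA ne by (auto simp: m_def)
  have ck: "card (A - {m}) = k" using cA mA(1) by simp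
  have "A \<subseteq> {..m}" using mA(2) by blast
  then have "card A \<le> card {..m}" by (intro card_mono) auto
  then have km: "k \<le> m" using cA by simp
  have IH: "\<Sum>{..<k} \<le> \<Sum>(A - {m})" "\<Sum>(A - {m}) = \<Sum>{..<k} \<Longrightarrow> A - {m} = {..<k}"
    using Suc.IH[OF finite_Diff[OF fA] ck] by simp_all
  have s: "\<Sum>A = m + \<Sum>(A - {m})" using fA mA(1) by (rule sum.remove)
  have s2: "\<Sum>{..<Suc k} = k + \<Sum>{..<k}" by simp
  show ?case
  proof (intro conjI impI)
    show "\<Sum>{..<Suc k} \<le> \<Sum>A" using s s2 IH(1) km by linarith
    assume "\<Sum>A = \<Sum>{..<Suc k}"
    then have mk: "m = k" "\<Sum>(A - {m}) = \<Sum>{..<k}" using s s2 IH(1) km by linarith+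
    have "A = insert m (A - {m})" using mA(1) by blast
    also have "\<dots> = insert k {..<k}" by (simp only: IH(2)[OF mk(2)] mk(1)[symmetric])
    also have "\<dots> = {..<Suc k}" by (rule lessThan_Suc[symmetric])
    finally show "A = {..<Suc k}" .
  qed
next
  case 0
  then have "A = {}" by simp
  then show ?case by simp
qed

lemmas sum_lessThan_card_le = sum_lessThan_card_le_aux[OF _ refl]

section \<open>Compression with respect to two variables\<close>

context
  fixes x y :: nat
  assumes xy: "x \<noteq> y"
begin

definition rest :: "nat multiset \<Rightarrow> nat multiset" where
  "rest M = filter_mset (\<lambda>z. z \<noteq> x \<and> z \<noteq> y) M"

text \<open>The monomial w x^(e-b) y^b; the natural subtraction is exact only for b <= e, which
  \<open>fibre\<close> imposes.\<close>

definition pt :: "nat multiset \<Rightarrow> nat \<Rightarrow> nat \<Rightarrow> nat multiset" where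
  "pt w e b = w + replicate_mset (e - b) x + replicate_mset b y"

definition fibre :: "nat multiset set \<Rightarrow> nat multiset \<Rightarrow> nat \<Rightarrow> nat set" where
  "fibre F w e = {b. b \<le> e \<and> pt w e b \<in> F}"

text \<open>In each fibre, given by the part \<open>w\<close> prime to \<open>x\<close> and \<open>y\<close> and by the total degree \<open>e\<close> in \<open>x\<close> and \<open>y\<close>,
compression keeps the number of monomials and moves them to the smallest exponents of \<open>y\<close>.\<close>

definition compress :: "nat multiset set \<Rightarrow> nat multiset set" where
  "compress F = {M. count M y < card (fibre F (rest M) (count M x + count M y))}"

lemma pt_rest: "pt (rest M) (count M x + count M y) (count M y) = M"
  by (rule multiset_eqI) (use xy in \<open>simp add: pt_def rest_def\<close>)

lemma fibre_subset: "fibre F w e \<subseteq> {..e}"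
  by (auto simp: fibre_def)

lemma finite_fibre [simp]: "finite (fibre F w e)"
  by (rule finite_subset[OF fibre_subset]) simp

lemma card_fibre_le: "card (fibre F w e) \<le> Suc e"
  using card_mono[OF _ fibre_subset[of F w e]] by simp

lemma rest_pt: "x \<notin># w \<Longrightarrow> y \<notin># w \<Longrightarrow> rest (pt w e b) = w"
  by (rule multiset_eqI) (simp add: rest_def pt_def count_eq_zero_iff[THEN iffD2])

lemma count_pt:
  assumes "x \<notin># w" "y \<notin># w" "b \<le> e"
  shows "count (pt w e b) y = b" "count (pt w e b) x + count (pt w e b) y = e"
  using assms xy by (simp_all add: pt_def count_eq_zero_iff[THEN iffD2])

lemma fibre_compress:
  assumes "x \<notin># w" "y \<notin># w"
  shows "fibre (compress F) w e = {..<card (fibre F w e)}"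
proof -
  have "pt w e b \<in> compress F \<longleftrightarrow> b < card (fibre F w e)" if "b \<le> e" for b
    using count_pt[OF assms that] rest_pt[OF assms] by (simp add: compress_def)
  then show ?thesis
    using card_fibre_le[of F w e] by (force simp: fibre_def[of "compress F"])
qed

text \<open>Coordinates on \<open>F\<close>: the part prime to \<open>x\<close> and
  \<open>y\<close>, the total degree in them, and the exponent of \<open>y\<close>. The index set
  \<open>K\<close> is left free so that \<open>F\<close> and \<open>compress F\<close> can be summed
  over the same one.\<close>

lemma bij_pt:
  assumes K: "\<And>w e. (w, e) \<in> K \<Longrightarrow> x \<notin># w \<and> y \<notin># w"
    and KF: "\<And>M. M \<in> F \<Longrightarrow> (rest M, count M x + count M y) \<in> K"
  shows "bij_betw (\<lambda>((w, e), b). pt w e b) (Sigma K (\<lambda>(w, e). fibre F w e)) F"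
proof (rule bij_betw_byWitness[where f' = "\<lambda>M. ((rest M, count M x + count M y), count M y)"])
  show "\<forall>q\<in>Sigma K (\<lambda>(w, e). fibre F w e).
      (\<lambda>M. ((rest M, count M x + count M y), count M y)) ((\<lambda>((w, e), b). pt w e b) q) = q"
  proof
    fix q assume q1: "q \<in> Sigma K (\<lambda>(w, e). fibre F w e)"
    obtain w e b where q: "q = ((w, e), b)" by (metis surj_pair)
    then have "(w, e) \<in> K" "b \<le> e" using q1 by (auto simp: fibre_def)
    then show "(\<lambda>M. ((rest M, count M x + count M y), count M y)) ((\<lambda>((w, e), b). pt w e b) q) = q"
      using K[of w e] q count_pt[of w b e] rest_pt[of w e b] by simp
  qed
next
  show "(\<lambda>((w, e), b). pt w e b) ` Sigma K (\<lambda>(w, e). fibre F w e) \<subseteq> F"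
    by (auto simp: fibre_def)
  show "(\<lambda>M. ((rest M, count M x + count M y), count M y)) ` F \<subseteq> Sigma K (\<lambda>(w, e). fibre F w e)"
  proof (rule image_subsetI)
    fix M assume M: "M \<in> F"
    then have "count M y \<in> fibre F (rest M) (count M x + count M y)"
      by (simp add: fibre_def pt_rest)
    then show "((rest M, count M x + count M y), count M y) \<in> Sigma K (\<lambda>(w, e). fibre F w e)"
      using KF[OF M] by simp
  qed
  show "\<forall>M\<in>F. (\<lambda>((w, e), b). pt w e b) ((rest M, count M x + count M y), count M y) = M"
    by (simp add: pt_rest)
qed

lemma sum_fibres:
  fixes f :: "nat multiset \<Rightarrow> nat"
  assumes K: "\<And>w e. (w, e) \<in> K \<Longrightarrow> x \<notin># w \<and> y \<notin># w"
    and KF: "\<And>M. M \<in> F \<Longrightarrow> (rest M, count M x + count M y) \<in> K"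
    and fin: "finite K"
  shows "sum f F = (\<Sum>(w, e)\<in>K. \<Sum>b\<in>fibre F w e. f (pt w e b))"
proof -
  have "sum f F = (\<Sum>q\<in>Sigma K (\<lambda>(w, e). fibre F w e). f ((\<lambda>((w, e), b). pt w e b) q))"
    using sum.reindex_bij_betw[OF bij_pt[OF K KF], where g = f] by simp
  also have "\<dots> = (\<Sum>p\<in>K. \<Sum>b\<in>(\<lambda>(w, e). fibre F w e) p. f ((\<lambda>(w, e). pt w e b) p))"
    using fin by (subst sum.Sigma) (auto simp: case_prod_unfold intro!: sum.cong)
  finally show ?thesis by (simp add: case_prod_unfold)
qed

lemma compress_msets:
  assumes "F \<subseteq> msets n d" "x < n" "y < n"
  shows "compress F \<subseteq> msets n d"
proof
  fix M assume "M \<in> compress F"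
  then have "fibre F (rest M) (count M x + count M y) \<noteq> {}" by (auto simp: compress_def)
  then obtain b where b: "b \<le> count M x + count M y" "pt (rest M) (count M x + count M y) b \<in> F"
    by (auto simp: fibre_def)
  then have 1: "pt (rest M) (count M x + count M y) b \<in> msets n d" using assms by auto
  have "size M = size (pt (rest M) (count M x + count M y) (count M y))" by (simp add: pt_rest)
  also have "\<dots> = size (pt (rest M) (count M x + count M y) b)" using b by (simp add: pt_def)
  also have "\<dots> = d" using 1 by (simp add: msets_def)
  finally have "size M = d" .
  moreover have "set_mset M \<subseteq> set_mset (rest M) \<union> {x, y}" by (auto simp: rest_def)
  moreover have "set_mset (rest M) \<subseteq> {..<n}" using 1 by (auto simp: msets_def pt_def)
  ultimately show "M \<in> msets n d" using assms by (auto simp: msets_def)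
qed

text \<open>The weight counts the factors other than \<open>x\<close>; on a fibre it is a constant
  plus the exponent of \<open>y\<close>. Compression keeps the fibre sizes and minimises these sums,
  strictly on a fibre that is not an initial segment.\<close>

lemma compress_sums:
  assumes "F \<subseteq> msets n d" "x < n" "y < n"
  shows card_compress: "card (compress F) = card F"
    and "add_mset y N \<in> F \<Longrightarrow> add_mset x N \<notin> F \<Longrightarrow>
      (\<Sum>M\<in>compress F. size (filter_mset (\<lambda>z. z \<noteq> x) M)) < (\<Sum>M\<in>F. size (filter_mset (\<lambda>z. z \<noteq> x) M))"
proof -
  define K where "K = (\<lambda>M. (rest M, count M x + count M y)) ` (F \<union> compress F)"
  have fin: "finite F" "finite (compress F)"
    using assms compress_msets[OF assms] finite_msets finite_subset by metis+
  have K: "x \<notin># w \<and> y \<notin># w" if "(w, e) \<in> K" for w e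
    using that by (auto simp: K_def rest_def)
  have KF: "(rest M, count M x + count M y) \<in> K" if "M \<in> F" for M using that by (auto simp: K_def)
  have KC: "(rest M, count M x + count M y) \<in> K" if "M \<in> compress F" for M using that by (auto simp: K_def)
  have fK: "finite K" using fin by (simp add: K_def)
  let ?u = "\<lambda>M. size (filter_mset (\<lambda>z. z \<noteq> x) M)"
  have "card (compress F) = (\<Sum>(w, e)\<in>K. card (fibre (compress F) w e))"
    using sum_fibres[OF K KC fK, where f = "\<lambda>_. 1"] by simp
  also have "\<dots> = (\<Sum>(w, e)\<in>K. card (fibre F w e))"
    using K by (intro sum.cong) (auto simp: fibre_compress)
  also have "\<dots> = card F"
    using sum_fibres[OF K KF fK, where f = "\<lambda>_. 1"] by simp
  finally show "card (compress F) = card F" .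
  have u: "?u (pt w e b) = size w + b" if "(w, e) \<in> K" for w e b
  proof -
    have "filter_mset (\<lambda>z. z \<noteq> x) (pt w e b) = w + replicate_mset b y"
      by (rule multiset_eqI) (use K[OF that] xy in \<open>simp add: pt_def count_eq_zero_iff[THEN iffD2]\<close>)
    then show ?thesis by simp
  qed
  have uF: "sum ?u G = (\<Sum>(w, e)\<in>K. card (fibre G w e) * size w + \<Sum>(fibre G w e))"
    if "G = F \<or> G = compress F" for G
  proof -
    have "sum ?u G = (\<Sum>(w, e)\<in>K. \<Sum>b\<in>fibre G w e. ?u (pt w e b))"
      using that by (intro sum_fibres[OF K _ fK]) (auto simp: KF KC)
    also have "\<dots> = (\<Sum>(w, e)\<in>K. card (fibre G w e) * size w + \<Sum>(fibre G w e))"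
      by (intro sum.cong) (auto simp: u sum.distrib)
    finally show ?thesis .
  qed
  have le: "(case p of (w, e) \<Rightarrow> card (fibre (compress F) w e) * size w + \<Sum>(fibre (compress F) w e))
      \<le> (case p of (w, e) \<Rightarrow> card (fibre F w e) * size w + \<Sum>(fibre F w e))" if "p \<in> K" for p
    using that K sum_lessThan_card_le[OF finite_fibre] by (cases p) (auto simp: fibre_compress)
  assume N: "add_mset y N \<in> F" "add_mset x N \<notin> F"
  define w e b where "w = rest N" and "e = count N x + count N y" and "b = count N y"
  have w: "x \<notin># w" "y \<notin># w" by (auto simp: w_def rest_def)
  have "N = pt w e b" by (simp add: w_def e_def b_def pt_rest)
  moreover have "b \<le> e" by (simp add: b_def e_def)
  \<comment> \<open>Both monomials lie in one fibre at adjacent exponents. The lower one is missing,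
    so this fibre is not an initial segment.\<close>
  ultimately have p: "add_mset y N = pt w (Suc e) (Suc b)" "add_mset x N = pt w (Suc e) b"
    by (simp_all add: pt_def Suc_diff_le)
  have inK: "(w, Suc e) \<in> K"
    using KF[OF N(1)] xy by (simp add: w_def e_def rest_def)
  have "Suc b \<in> fibre F w (Suc e)" "b \<notin> fibre F w (Suc e)"
    using N p \<open>b \<le> e\<close> by (auto simp: fibre_def)
  then have "fibre F w (Suc e) \<noteq> {..<card (fibre F w (Suc e))}" by (metis Suc_lessD lessThan_iff)
  then have "\<Sum>{..<card (fibre F w (Suc e))} < \<Sum>(fibre F w (Suc e))"
    using sum_lessThan_card_le[OF finite_fibre, of F w "Suc e"] by linarith
  then have lt: "(case (w, Suc e) of (w, e) \<Rightarrow> card (fibre (compress F) w e) * size w + \<Sum>(fibre (compress F) w e))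
      < (case (w, Suc e) of (w, e) \<Rightarrow> card (fibre F w e) * size w + \<Sum>(fibre F w e))"
    using w by (simp add: fibre_compress)
  show "sum ?u (compress F) < sum ?u F"
    unfolding uF[OF disjI1[OF refl]] uF[OF disjI2[OF refl]]
    by (rule sum_strict_mono_ex1[OF fK]) (use le lt inK in blast)+
qed

text \<open>Where the divisions are possible, an exponent \<open>b\<close> gives \<open>b\<close>
  after division by \<open>x\<close> and b - 1 after division by \<open>y\<close>. The minimum
  accounts for a complete fibre, which has e + 2 elements while its shadow has e + 1.\<close>

lemma card_fibre_shadow:
  "min (card (fibre F w (Suc e))) (Suc e) \<le> card (fibre (shadow F) w e)"
proof -
  let ?A = "fibre F w (Suc e)"
  have A: "b \<in> fibre (shadow F) w e" if "b \<le> e" "b \<in> ?A \<or> Suc b \<in> ?A" for b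
  proof -
    have "pt w (Suc e) (Suc b) = add_mset y (pt w e b)" "pt w (Suc e) b = add_mset x (pt w e b)"
      using that by (simp_all add: pt_def Suc_diff_le)
    then show ?thesis using that by (auto simp: fibre_def shadow_def)
  qed
  show ?thesis
  proof (cases "\<exists>g\<le>Suc e. g \<notin> ?A")
    case True
    then obtain g where g: "g \<le> Suc e" "g \<notin> ?A" by blast
    \<comment> \<open>Exponents below the gap \<open>g\<close> are divided by \<open>x\<close>,
      those above it by \<open>y\<close>; the gap keeps the shift injective.\<close>
    define \<phi> where "\<phi> b = (if b < g then b else b - 1)" for b
    have ng: "b \<noteq> g" "b \<le> Suc e" if "b \<in> ?A" for b using that g by (auto simp: fibre_def)
    have "inj_on \<phi> ?A"
    proof (rule inj_onI)
      fix b c assume "b \<in> ?A" "c \<in> ?A" "\<phi> b = \<phi> c"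
      then show "b = c" using ng(1)[of b] ng(1)[of c] by (simp add: \<phi>_def split: if_splits)
    qed
    moreover have "\<phi> ` ?A \<subseteq> fibre (shadow F) w e"
    proof
      fix c assume "c \<in> \<phi> ` ?A"
      then obtain b where b: "b \<in> ?A" "c = \<phi> b" by blast
      show "c \<in> fibre (shadow F) w e"
      proof (cases "b < g")
        case True then show ?thesis using b g A[of b] by (simp add: \<phi>_def)
      next
        case False
        then have "b = Suc (b - 1)" using ng(1)[OF b(1)] by linarith
        then show ?thesis using b False A[of "b - 1"] ng(2)[OF b(1)] by (simp add: \<phi>_def)
      qed
    qed
    ultimately have "card ?A \<le> card (fibre (shadow F) w e)" by (metis card_image card_mono finite_fibre)
    then show ?thesis by simp
  next
    case False
    then have "{..e} \<subseteq> fibre (shadow F) w e" using A by auto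
    then show ?thesis using card_mono[OF finite_fibre, of "{..e}" "shadow F" w e] by simp
  qed
qed

text \<open>If the removed variable is \<open>x\<close> or \<open>y\<close>, the exponent of
  \<open>y\<close> in \<open>N\<close> is at most \<open>e\<close>, so the minimum in
  \<open>card_fibre_shadow\<close> does no harm. Any other variable \<open>z\<close> puts the fibre
  over \<open>z w\<close> inside the fibre of the shadow over \<open>w\<close>.\<close>

lemma shadow_compress: "shadow (compress F) \<subseteq> compress (shadow F)"
proof
  fix N assume "N \<in> shadow (compress F)"
  then obtain z where z: "add_mset z N \<in> compress F" by (auto simp: shadow_def)
  define w e where "w = rest N" and "e = count N x + count N y"
  consider "z = x" | "z = y" | "z \<noteq> x" "z \<noteq> y" by blast
  then show "N \<in> compress (shadow F)"
  proof cases
    case 1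
    then have "count N y < card (fibre F w (Suc e))" "count N y \<le> e"
      using z xy by (auto simp: compress_def w_def e_def rest_def)
    then show ?thesis using card_fibre_shadow[of F w e] by (auto simp: compress_def w_def e_def)
  next
    case 2
    then have "Suc (count N y) < card (fibre F w (Suc e))" "count N y \<le> e"
      using z xy by (auto simp: compress_def w_def e_def rest_def)
    then show ?thesis using card_fibre_shadow[of F w e] by (auto simp: compress_def w_def e_def)
  next
    case 3
    then have "count N y < card (fibre F (add_mset z w) e)"
      using z xy by (auto simp: compress_def w_def e_def rest_def)
    moreover have "fibre F (add_mset z w) e \<subseteq> fibre (shadow F) w e"
      by (auto simp: fibre_def shadow_def pt_def)
    ultimately show ?thesis
      using card_mono[OF finite_fibre, of "fibre F (add_mset z w) e" "shadow F" w e]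
      by (simp add: compress_def w_def e_def)
  qed
qed

end

text \<open>Among the sets of the same size with no larger shadow, take one of least weight. If it
  were not stable, a compression would keep both properties and lower the weight.\<close>

lemma exists_stable:
  assumes F: "F \<subseteq> msets n (Suc d)" and x: "x < n"
  obtains G where "G \<subseteq> msets n (Suc d)" "stable x G" "card G = card F"
    "card (shadow G) \<le> card (shadow F)"
proof -
  define P where "P G \<longleftrightarrow> G \<subseteq> msets n (Suc d) \<and> card G = card F \<and> card (shadow G) \<le> card (shadow F)" for G
  let ?wt = "\<lambda>G. \<Sum>M\<in>G. size (filter_mset (\<lambda>z. z \<noteq> x) M)"
  have "P F" using F by (simp add: P_def)
  then obtain G where G: "P G" and min: "\<And>H. P H \<Longrightarrow> ?wt G \<le> ?wt H"
    using ex_has_least_nat[of P F ?wt] by blast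
  have "stable x G"
  proof (rule ccontr)
    assume "\<not> stable x G"
    then obtain N y where N: "add_mset y N \<in> G" "add_mset x N \<notin> G" by (auto simp: stable_def)
    then have xy: "x \<noteq> y" by auto
    have Gm: "G \<subseteq> msets n (Suc d)" using G by (simp add: P_def)
    have y: "y < n" using N Gm by (auto simp: msets_def)
    have "card (shadow (compress x y G)) \<le> card (compress x y (shadow G))"
      using compress_msets[OF xy shadow_msets[OF Gm] x y] finite_msets
      by (intro card_mono shadow_compress[OF xy]) (auto intro: finite_subset)
    also have "\<dots> = card (shadow G)" by (rule card_compress[OF xy shadow_msets[OF Gm] x y])
    finally have "P (compress x y G)"
      using G compress_msets[OF xy Gm x y] card_compress[OF xy Gm x y] by (simp add: P_def)
    then show False using min compress_sums(2)[OF xy Gm x y N] by fastforce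
  qed
  then show thesis using G that by (auto simp: P_def)
qed

text \<open>Green's bound in degree \<open>d\<close> is a hypothesis because
  \<open>green_stable\<close> calls this lemma inside its own induction on \<open>d\<close>. The
  induction here is on the number of variables: the set is made stable for the last variable, and
  the monomials prime to it live in one variable less.\<close>

lemma mac_shadow_step:
  assumes green: "\<And>F n x. F \<subseteq> msets n d \<Longrightarrow> stable x F \<Longrightarrow> card {M \<in> F. x \<notin># M} \<le> mac_down d (card F)"
    and d: "d \<ge> 1" and F: "F \<subseteq> msets n (Suc d)"
  shows "card F \<le> mac_up d (card (shadow F))"
  using F
proof (induction n arbitrary: F)
  case 0
  then have "F = {}" by (auto simp: msets_def)
  then show ?case by simp
next
  case (Suc n)
  obtain G where G: "G \<subseteq> msets (Suc n) (Suc d)" "stable n G" "card G = card F"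
    "card (shadow G) \<le> card (shadow F)" using exists_stable[OF Suc.prems, of n] by auto
  let ?G0 = "{M \<in> G. n \<notin># M}"
  have "?G0 \<subseteq> msets n (Suc d)" using G(1) by (force simp: msets_def less_Suc_eq)
  then have "card ?G0 \<le> mac_up d (card (shadow ?G0))" by (rule Suc.IH)
  also have "\<dots> \<le> mac_up d (card {M \<in> shadow G. n \<notin># M})"
    using finite_shadow[OF G(1)]
    by (intro mac_up_mono card_mono) (auto simp: shadow_def)
  also have "\<dots> \<le> mac_up d (mac_down d (card (shadow G)))"
    using green[OF shadow_msets[OF G(1)] stable_shadow[OF G(2)]] by (rule mac_up_mono)
  finally have "card G \<le> card (shadow G) + mac_up d (mac_down d (card (shadow G)))"
    using card_stable[OF G(2)] finite_subset[OF G(1) finite_msets] by simp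
  also have "\<dots> = mac_up d (card (shadow G))" using d by (intro mac_up_down) auto
  also have "\<dots> \<le> mac_up d (card (shadow F))" using G(4) by (rule mac_up_mono)
  finally show ?case using G(3) by simp
qed

text \<open>The part of \<open>F\<close> prime to \<open>x\<close> obeys Macaulay's bound by the
  induction hypothesis in degree \<open>d\<close>, and its shadow lies in the part of
  \<open>shadow F\<close> prime to \<open>x\<close>. \<open>mac_down_bound\<close> turns the
  resulting estimate into one by the size of \<open>F\<close>.\<close>

lemma green_stable:
  assumes "d \<ge> 1" "F \<subseteq> msets n d" "stable x F"
  shows "card {M \<in> F. x \<notin># M} \<le> mac_down d (card F)"
  using assms
proof (induction d arbitrary: F n x rule: nat_induct_at_least)
  case base
  show ?case
  proof (cases "F = {}")
    case False
    then obtain M where M: "M \<in> F" by blast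
    then have "size M = 1" using base by (auto simp: msets_def)
    then obtain y where "M = add_mset y {#}" using size_1_singleton_mset by blast
    \<comment> \<open>A nonempty stable set of degree one contains \<open>x\<close> itself, and
      lowering in degree one subtracts one.\<close>
    then have "add_mset x {#} \<in> F" using base(2) M unfolding stable_def by metis
    then have x: "{#x#} \<in> F" by simp
    have fin: "finite F" using base(1) finite_msets finite_subset by blast
    have "{#x#} \<notin> {M \<in> F. x \<notin># M}" by simp
    then have "{M \<in> F. x \<notin># M} \<subset> F" using x by blast
    then have "card {M \<in> F. x \<notin># M} < card F" by (rule psubset_card_mono[OF fin])
    moreover have "mac_down 1 (card F) = card F - 1"
      using mac_down_rec[of 0 "card F" 0] by simp
    ultimately show ?thesis by simp
  qed simp
next
  case (Suc d)
  let ?F0 = "{M \<in> F. x \<notin># M}"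
  have F0: "?F0 \<subseteq> msets n (Suc d)" using Suc.prems(1) by blast
  have "card ?F0 \<le> mac_up d (card (shadow ?F0))"
    using Suc.IH Suc.hyps by (intro mac_shadow_step[OF _ _ F0]) auto
  also have "\<dots> \<le> mac_up d (card {M \<in> shadow F. x \<notin># M})"
    using finite_shadow[OF Suc.prems(1)]
    by (intro mac_up_mono card_mono) (auto simp: shadow_def)
  also have "\<dots> \<le> mac_up d (mac_down d (card (shadow F)))"
    using Suc.IH[OF shadow_msets[OF Suc.prems(1)] stable_shadow[OF Suc.prems(2)]]
    by (rule mac_up_mono)
  finally have "card ?F0 \<le> mac_down (Suc d) (card (shadow F) + card ?F0)"
    using Suc.hyps by (intro mac_down_bound) auto
  then show ?case
    using card_stable[OF Suc.prems(2)] finite_subset[OF Suc.prems(1) finite_msets] by simp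
qed

theorem macaulay_shadow:
  assumes "d \<ge> 1" "F \<subseteq> msets n (Suc d)"
  shows "card F \<le> mac_up d (card (shadow F))"
  by (rule mac_shadow_step[OF green_stable[OF assms(1)] assms])

section \<open>Finite-dimensional linear algebra\<close>

locale lin_space = vector_space scale
  for scale :: "'a::field \<Rightarrow> 'b::ab_group_add \<Rightarrow> 'b"
begin

text \<open>The space of all polynomials is infinite-dimensional, so finiteness is imposed on
  individual subsets.\<close>

definition fin_dim :: "'b set \<Rightarrow> bool" where
  "fin_dim V \<longleftrightarrow> (\<exists>B. finite B \<and> V \<subseteq> span B)"

lemma fin_dim_subset: "fin_dim V \<Longrightarrow> U \<subseteq> V \<Longrightarrow> fin_dim U"
  unfolding fin_dim_def by blast

lemma fin_dim_basis:
  assumes "fin_dim V"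
  obtains B :: "'b set" where "B \<subseteq> V" "independent B" "V \<subseteq> span B" "card B = dim V" "finite B"
proof -
  obtain T where T: "finite T" "V \<subseteq> span T" using assms by (auto simp: fin_dim_def)
  obtain B where B: "B \<subseteq> V" "independent B" "V \<subseteq> span B" "card B = dim V"
    using basis_exists by blast
  then have "finite B" using independent_span_bound[OF T(1) B(2)] T(2) by blast
  then show thesis using B that by blast
qed

lemma independent_card_le_dim:
  assumes "fin_dim V" "independent S" "S \<subseteq> V"
  shows "finite S" "card S \<le> dim V"
proof -
  obtain B where B: "B \<subseteq> V" "independent B" "V \<subseteq> span B" "card B = dim V" "finite B"
    using fin_dim_basis[OF assms(1)] by metis
  have "finite S \<and> card S \<le> card B"
    using independent_span_bound[OF B(5) assms(2)] assms(3) B(3) by blast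
  then show "finite S" "card S \<le> dim V" using B(4) by auto
qed

lemma fin_dim_mono:
  assumes "fin_dim V" "U \<subseteq> V"
  shows "dim U \<le> dim V"
proof -
  obtain B where "B \<subseteq> U" "independent B" "card B = dim U" using basis_exists by metis
  then show ?thesis using independent_card_le_dim[OF assms(1)] assms(2) by force
qed

lemma independent_card_eq_spans:
  assumes "fin_dim V" "independent S" "S \<subseteq> V" "card S \<ge> dim V"
  shows "V \<subseteq> span S"
proof
  fix v assume v: "v \<in> V"
  show "v \<in> span S"
  proof (rule ccontr)
    assume n: "v \<notin> span S"
    then have "independent (insert v S)" using assms(2) by (rule independent_insertI)
    then have "card (insert v S) \<le> dim V"
      using independent_card_le_dim[OF assms(1)] v assms(3) by blast
    moreover have "v \<notin> S" using n span_base by blast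
    ultimately show False
      using assms(4) independent_card_le_dim(1)[OF assms(1-3)] by simp
  qed
qed

lemma fin_dim_eq:
  assumes "fin_dim V" "subspace U" "U \<subseteq> V" "dim V \<le> dim U"
  shows "U = V"
proof -
  obtain B where B: "B \<subseteq> U" "independent B" "card B = dim U" using basis_exists by metis
  have "V \<subseteq> span B" using independent_card_eq_spans[OF assms(1) B(2)] B assms by auto
  then show ?thesis using B(1) assms(2,3) span_minimal by blast
qed

lemma dim_zero_iff:
  assumes "fin_dim V"
  shows "dim V = 0 \<longleftrightarrow> V \<subseteq> {0}"
proof
  obtain B where B: "V \<subseteq> span B" "card B = dim V" "finite B"
    using fin_dim_basis[OF assms] by metis
  assume "dim V = 0"
  then show "V \<subseteq> {0}" using B by simp
next
  assume "V \<subseteq> {0}"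
  then have "dim V \<le> card ({}::'b set)" by (intro dim_le_card) auto
  then show "dim V = 0" by simp
qed

text \<open>The coordinates of \<open>v\<close> with respect to \<open>B\<close> vanish outside
  \<open>S\<close> and outside \<open>T\<close>.\<close>

lemma independent_disjoint_spans:
  assumes "independent B" "v \<in> span S" "v \<in> span T" "S \<subseteq> B" "T \<subseteq> B" "S \<inter> T = {}"
  shows "v = 0"
proof -
  have "representation B v = representation S v" "representation B v = representation T v"
    using representation_extend[OF assms(1,2,4)] representation_extend[OF assms(1,3,5)] by simp_all
  then have "representation S v b = 0" for b
    using assms(6) representation_ne_zero[of S v b] representation_ne_zero[of T v b] by auto
  then show ?thesis
    using sum_nonzero_representation_eq[OF independent_mono[OF assms(1,4)] assms(2)] by simp
qed

lemma rank_nullity: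
  assumes lin: "Vector_Spaces.linear scale scale f" and V: "subspace V" "fin_dim V"
  shows "dim V = dim {v \<in> V. f v = 0} + dim (f ` V)" and "fin_dim (f ` V)"
proof -
  interpret f: Vector_Spaces.linear scale scale f by (fact lin)
  let ?K = "{v \<in> V. f v = 0}"
  obtain B0 where B0: "B0 \<subseteq> ?K" "independent B0" "?K \<subseteq> span B0" "card B0 = dim ?K" "finite B0"
    using fin_dim_basis[OF fin_dim_subset[OF V(2)], of ?K] by blast
  have "B0 \<subseteq> V" using B0(1) by blast
  then obtain B where B: "B0 \<subseteq> B" "B \<subseteq> V" "independent B" "V \<subseteq> span B"
    using maximal_independent_subset_extend[OF _ B0(2)] by metis
  have finB: "finite B" using independent_card_le_dim(1)[OF V(2) B(3,2)] .
  have cB: "card B = dim V" using basis_card_eq_dim[OF B(2,4,3)] .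
  let ?C = "B - B0"
  have spanC: "span ?C \<subseteq> V" using B(2) V(1) by (intro span_minimal) auto
  \<comment> \<open>The vectors added to a basis of the kernel span a complement of it in
    \<open>V\<close>.\<close>
  have ker: "v = 0" if "v \<in> span ?C" "f v = 0" for v
    by (rule independent_disjoint_spans[OF B(3) that(1)]) (use that spanC B0(3) B(1) in auto)
  have inj: "inj_on f (span ?C)"
  proof (rule inj_onI)
    fix u v assume "u \<in> span ?C" "v \<in> span ?C" "f u = f v"
    then have "u - v \<in> span ?C" "f (u - v) = 0" by (simp_all add: span_diff f.diff)
    then have "u - v = 0" by (rule ker)
    then show "u = v" by simp
  qed
  have indC: "independent (f ` ?C)"
    using f.independent_injective_image[OF independent_mono[OF B(3)] inj] by blast
  have cardC: "card (f ` ?C) = card ?C"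
    by (rule card_image[OF inj_on_subset[OF inj span_superset]])
  have spans: "f ` V \<subseteq> span (f ` ?C)"
  proof -
    have "f ` V \<subseteq> f ` span B" using B(4) by blast
    also have "\<dots> = span (f ` B)" by (rule f.span_image[symmetric])
    also have "\<dots> \<subseteq> span (f ` ?C)"
    proof (rule span_minimal)
      show "f ` B \<subseteq> span (f ` ?C)"
      proof (rule image_subsetI)
        fix b assume "b \<in> B"
        show "f b \<in> span (f ` ?C)"
        proof (cases "b \<in> B0")
          case True
          then have "f b = 0" using B0(1) by blast
          then show ?thesis by (simp add: span_zero)
        next
          case False
          then show ?thesis using \<open>b \<in> B\<close> by (intro span_base) blast
        qed
      qed
    qed simp
    finally show ?thesis .
  qed
  have "card (f ` ?C) = dim (f ` V)"
    by (rule basis_card_eq_dim[OF _ spans indC]) (use B(2) in blast)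
  moreover have "card ?C + card B0 = card B"
    using finB B(1) B0(5) by (simp add: card_Diff_subset card_mono)
  ultimately show "dim V = dim ?K + dim (f ` V)" using cardC cB B0(4) by simp
  show "fin_dim (f ` V)" unfolding fin_dim_def using spans finB by (intro exI[of _ "f ` ?C"]) simp
qed

text \<open>On the kernel of one map the others still have trivial common kernel, and the rank of
  that map is at most the dimension of \<open>W\<close>; rank-nullity adds the two bounds.\<close>

lemma joint_kernel_dim:
  assumes "finite X" "\<And>i. i \<in> X \<Longrightarrow> Vector_Spaces.linear scale scale (g i)"
    and "subspace V" "fin_dim V" "fin_dim W" "\<And>i. i \<in> X \<Longrightarrow> g i ` V \<subseteq> W"
    and "\<And>v. v \<in> V \<Longrightarrow> \<forall>i\<in>X. g i v = 0 \<Longrightarrow> v = 0"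
  shows "dim V \<le> card X * dim W"
  using assms
proof (induction X arbitrary: V rule: finite_induct)
  case empty
  then have "V \<subseteq> {0}" by auto
  then show ?case using dim_zero_iff[OF empty.prems(3)] by simp
next
  case (insert i X)
  interpret gi: Vector_Spaces.linear scale scale "g i" using insert.prems(1) by blast
  let ?K = "{v \<in> V. g i v = 0}"
  have K: "subspace ?K" using insert.prems(2) gi.zero gi.add gi.scale
    by (auto simp: subspace_def)
  have "dim ?K \<le> card X * dim W"
  proof (rule insert.IH)
    show "fin_dim ?K" using insert.prems(3) by (rule fin_dim_subset) blast
    show "g j ` ?K \<subseteq> W" if "j \<in> X" for j using insert.prems(5)[of j] that by blast
  qed (use K insert.prems in blast)+
  moreover have "dim (g i ` V) \<le> dim W"
    using insert.prems(4,5) by (intro fin_dim_mono) auto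
  ultimately show ?case
    using rank_nullity(1)[OF _ insert.prems(2,3), of "g i"] insert by simp
qed

text \<open>Realises the quotient by \<open>U\<close> inside the same space, \<open>p\<close>
  choosing a representative of each class. Extend a basis of \<open>U\<close> to the whole space,
  send the basis of \<open>U\<close> to zero and fix the added vectors.\<close>

lemma exists_projection:
  assumes U: "subspace U"
  obtains p where "Vector_Spaces.linear scale scale p" "\<And>x. p x = 0 \<longleftrightarrow> x \<in> U" "\<And>x. x - p x \<in> U"
proof -
  interpret vp: vector_space_pair scale scale ..
  obtain B0 where B0: "B0 \<subseteq> U" "independent B0" "U \<subseteq> span B0"
    using maximal_independent_subset[of U] by metis
  obtain B where B: "B0 \<subseteq> B" "independent B" "UNIV \<subseteq> span B"
    using maximal_independent_subset_extend[OF subset_UNIV B0(2)] by metis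
  obtain p where p: "Vector_Spaces.linear scale scale p" "\<And>b. b \<in> B \<Longrightarrow> p b = (if b \<in> B0 then 0 else b)"
    using vp.linear_independent_extend[OF B(2), of "\<lambda>b. if b \<in> B0 then 0 else b"] by blast
  interpret p: Vector_Spaces.linear scale scale p by (fact p(1))
  have diff: "x - p x \<in> U" for x
  proof -
    have "x \<in> span B" using B(3) by blast
    then show ?thesis
    proof (induction rule: span_induct_alt)
      case base
      then show ?case using U by (simp add: p.zero subspace_0)
    next
      case (step c b y)
      have "b - p b \<in> U" using p(2)[OF step(1)] B0(1) U by (auto simp: subspace_0)
      then have "scale c (b - p b) + (y - p y) \<in> U"
        using step(2) U by (intro subspace_add subspace_scale)
      then show ?case by (simp add: p.add p.scale algebra_simps)
    qed
  qed
  have zero: "p x = 0" if "x \<in> U" for x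
  proof -
    have "x \<in> span B0" using that B0(3) by blast
    then show ?thesis
      by (rule p.eq_0_on_span[rotated]) (use p(2) B(1) in auto)
  qed
  show thesis
  proof (rule that[OF p(1) _ diff])
    show "p x = 0 \<longleftrightarrow> x \<in> U" for x using zero[of x] diff[of x] by auto
  qed
qed

text \<open>Scanning by increasing index, keep the vectors outside the span of their predecessors.
  Appending a largest index leaves earlier choices unchanged. For monomials this selects the
  standard ones.\<close>

lemma greedy_basis:
  fixes v :: "'c::linorder \<Rightarrow> 'b"
  assumes "finite M"
  defines "B \<equiv> {m \<in> M. v m \<notin> span (v ` {m' \<in> M. m' < m})}"
  shows "card B = dim (v ` M)"
proof -
  define S where "S M = {m \<in> M. v m \<notin> span (v ` {m' \<in> M. m' < m})}" for M
  have "inj_on v (S M) \<and> independent (v ` S M) \<and> v ` M \<subseteq> span (v ` S M)"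
    using assms(1)
  proof (induction M rule: finite_linorder_max_induct)
    case empty
    then show ?case by (simp add: S_def independent_empty)
  next
    case (insert b A)
    have eq: "span (v ` S A) = span (v ` A)"
    proof (rule antisym)
      have "v ` S A \<subseteq> v ` A" by (auto simp: S_def)
      then show "span (v ` S A) \<subseteq> span (v ` A)" by (rule span_mono)
      show "span (v ` A) \<subseteq> span (v ` S A)" using insert.IH by (intro span_minimal) auto
    qed
    have b: "{m' \<in> insert b A. m' < b} = A" using insert.hyps(2) by auto
    have A: "{m' \<in> insert b A. m' < m} = {m' \<in> A. m' < m}" if "m \<in> A" for m
      using insert.hyps(2) that by (auto dest: order.asym)
    have "m \<in> S (insert b A) \<longleftrightarrow> m = b \<and> v b \<notin> span (v ` A) \<or> m \<in> S A" for m
    proof -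
      have "m \<in> S (insert b A) \<longleftrightarrow> m \<in> insert b A \<and> v m \<notin> span (v ` {m' \<in> insert b A. m' < m})"
        unfolding S_def by (rule mem_Collect_eq)
      moreover have "m \<in> S A \<longleftrightarrow> m \<in> A \<and> v m \<notin> span (v ` {m' \<in> A. m' < m})"
        unfolding S_def by (rule mem_Collect_eq)
      moreover have "b \<notin> A" using insert.hyps(2) by blast
      ultimately show ?thesis using b A by (cases "m = b"; cases "m \<in> A"; simp only: insert_iff; blast)
    qed
    then have S: "S (insert b A) = (if v b \<in> span (v ` A) then S A else insert b (S A))"
      by (intro Set.set_eqI) simp
    show ?case
    proof (cases "v b \<in> span (v ` A)")
      case True
      then show ?thesis using insert.IH S eq by auto
    next
      case False
      then have nv: "v b \<notin> span (v ` S A)" using eq by simp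
      then have "v b \<notin> v ` S A" using span_base by blast
      moreover have "independent (insert (v b) (v ` S A))"
        using insert.IH nv by (intro independent_insertI) auto
      moreover have "v ` insert b A \<subseteq> span (insert (v b) (v ` S A))"
        using insert.IH span_mono[of "v ` S A" "insert (v b) (v ` S A)"]
          span_base[of "v b" "insert (v b) (v ` S A)"] by auto
      ultimately show ?thesis using insert.IH S False by auto
    qed
  qed
  then have b: "inj_on v B" "independent (v ` B)" "v ` M \<subseteq> span (v ` B)" by (auto simp: S_def B_def)
  have "card (v ` B) = dim (v ` M)"
    by (rule basis_card_eq_dim[OF _ b(3,2)]) (auto simp: B_def)
  then show ?thesis using b(1) by (simp add: card_image)
qed

end

section \<open>Homogeneous polynomials\<close>

lemma const_single: "const c * Poly_Mapping.single m d = Poly_Mapping.single m (c * d)"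
  by (simp add: const_def mult_single)

lemma lookup_const_mult: "Poly_Mapping.lookup (const c * p) m = c * Poly_Mapping.lookup p m"
  by (simp add: const_def mult_map_scale_conv_mult[symmetric] Poly_Mapping.map.rep_eq when_def)

lemma const_simps: "const 0 = 0" "const 1 = 1" "const (a + b) = const a + const b" "const (a * b) = const a * const b"
  by (simp_all add: const_def single_add mult_single)

interpretation mp: lin_space "\<lambda>(c::'k::field) p. const c * p"
  by unfold_locales (simp_all only: const_simps distrib_left distrib_right mult.assoc mult_1_left)

lemma mdeg_superset: "finite S \<Longrightarrow> Poly_Mapping.keys m \<subseteq> S \<Longrightarrow> mdeg m = (\<Sum>i\<in>S. Poly_Mapping.lookup m i)"
  unfolding mdeg_def by (rule sum.mono_neutral_left) (auto simp: in_keys_iff)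

lemma mdeg_add: "mdeg (m + m') = mdeg m + mdeg m'"
  using keys_add[of m m']
  by (simp add: mdeg_superset[of "Poly_Mapping.keys m \<union> Poly_Mapping.keys m'"] lookup_add sum.distrib)

lemma mdeg_single: "mdeg (Poly_Mapping.single i k) = k"
  by (cases "k = 0") (simp_all add: mdeg_def)

lemma keys_add_nat: "Poly_Mapping.keys (m + m') = Poly_Mapping.keys m \<union> Poly_Mapping.keys (m' :: nat \<Rightarrow>\<^sub>0 nat)"
  by (auto simp: in_keys_iff lookup_add)

section \<open>Monomials as multisets\<close>

definition monoms :: "nat \<Rightarrow> nat \<Rightarrow> (nat \<Rightarrow>\<^sub>0 nat) set" where
  "monoms n d = {m. Poly_Mapping.keys m \<subseteq> {..<n} \<and> mdeg m = d}"

definition exps :: "(nat \<Rightarrow>\<^sub>0 nat) \<Rightarrow> nat multiset" where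
  "exps m = Abs_multiset (Poly_Mapping.lookup m)"

lemma count_exps: "count (exps m) = Poly_Mapping.lookup m"
  unfolding exps_def by (rule count_Abs_multiset) simp

lemma inj_exps: "inj exps"
proof (rule injI)
  fix m m' assume "exps m = exps m'"
  then have "Poly_Mapping.lookup m = Poly_Mapping.lookup m'" by (simp only: count_exps[symmetric])
  then show "m = m'" by (rule poly_mapping_eq_iff[THEN iffD2])
qed

lemma set_mset_exps: "set_mset (exps m) = Poly_Mapping.keys m"
  by (auto simp: set_mset_def count_exps in_keys_iff)

lemma size_exps: "size (exps m) = mdeg m"
  by (simp add: size_multiset_overloaded_eq set_mset_exps count_exps mdeg_def)

lemma exps_add_single: "exps (m + Poly_Mapping.single i 1) = add_mset i (exps m)"
  by (rule multiset_eqI) (auto simp: count_exps lookup_add lookup_single when_def)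

lemma exps_monoms: "exps ` monoms n d \<subseteq> msets n d"
  by (auto simp: monoms_def msets_def set_mset_exps size_exps)

lemma finite_monoms: "finite (monoms n d)"
  by (rule finite_imageD[OF finite_subset[OF exps_monoms finite_msets] inj_on_subset[OF inj_exps subset_UNIV]])

lemma monoms_0: "monoms n 0 = {0}"
proof -
  have "m = 0" if "mdeg m = 0" for m
    by (rule poly_mapping_eqI) (use that in \<open>auto simp: mdeg_def in_keys_iff\<close>)
  then show ?thesis by (auto simp: monoms_def mdeg_def)
qed

lemma monoms_add: "m \<in> monoms n d \<Longrightarrow> m' \<in> monoms n e \<Longrightarrow> m + m' \<in> monoms n (d + e)"
  by (auto simp: monoms_def mdeg_add keys_add_nat)

lemma single_in_monoms: "i < n \<Longrightarrow> Poly_Mapping.single i 1 \<in> monoms n 1"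
  by (simp add: monoms_def mdeg_single)

lemma monoms_Suc_split:
  assumes "m \<in> monoms n (Suc d)"
  obtains i m' where "i < n" "m' \<in> monoms n d" "m = Poly_Mapping.single i 1 + m'"
proof -
  have "Poly_Mapping.keys m \<noteq> {}" using assms by (auto simp: monoms_def mdeg_def)
  then obtain i where i: "i \<in> Poly_Mapping.keys m" by blast
  let ?m' = "m - Poly_Mapping.single i 1"
  have m: "m = Poly_Mapping.single i 1 + ?m'"
    by (rule poly_mapping_eqI)
      (use i in \<open>auto simp: lookup_add lookup_minus lookup_single when_def in_keys_iff\<close>)
  have "mdeg m = 1 + mdeg ?m'" by (subst m) (simp add: mdeg_add mdeg_single)
  moreover have "Poly_Mapping.keys m = {i} \<union> Poly_Mapping.keys ?m'"
    by (subst m) (simp add: keys_add_nat)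
  ultimately have "?m' \<in> monoms n d" "i < n" using assms by (auto simp: monoms_def)
  then show thesis using m that by blast
qed

lemma poly_mapping_sum_single:
  "p = (\<Sum>m\<in>Poly_Mapping.keys p. Poly_Mapping.single m (Poly_Mapping.lookup p m))"
  by (rule poly_mapping_eqI)
    (auto simp: lookup_sum lookup_single when_def in_keys_iff sum.delta)

section \<open>Graded pieces and homogeneous components\<close>

lemma Rpoly_iff: "p \<in> Rpoly n \<longleftrightarrow> (\<forall>m\<in>Poly_Mapping.keys p. Poly_Mapping.keys m \<subseteq> {..<n})"
  by (simp add: Rpoly_def)

lemma Rdeg_iff: "p \<in> Rdeg n d \<longleftrightarrow> Poly_Mapping.keys p \<subseteq> monoms n d"
  by (auto simp: Rdeg_def Rpoly_def homog_def monoms_def)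

lemma Rdeg_subset_Rpoly: "Rdeg n d \<subseteq> Rpoly n"
  by (auto simp: Rdeg_def)

lemma Rpoly_zero: "0 \<in> Rpoly n" by (simp add: Rpoly_iff)

lemma Rpoly_add: "p \<in> Rpoly n \<Longrightarrow> q \<in> Rpoly n \<Longrightarrow> p + q \<in> Rpoly n"
  unfolding Rpoly_iff using keys_add[of p q] by blast

lemma Rpoly_mult: "p \<in> Rpoly n \<Longrightarrow> q \<in> Rpoly n \<Longrightarrow> p * q \<in> Rpoly n"
proof -
  assume "p \<in> Rpoly n" "q \<in> Rpoly n"
  then have "Poly_Mapping.keys (a + b) \<subseteq> {..<n}"
    if "a \<in> Poly_Mapping.keys p" "b \<in> Poly_Mapping.keys q" for a b
    using that by (simp add: Rpoly_iff keys_add_nat)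
  then show ?thesis unfolding Rpoly_iff using keys_mult[of p q] by blast
qed

lemma Rpoly_const: "const c \<in> Rpoly n"
  by (simp add: Rpoly_iff const_def)

lemma Rpoly_var: "i < n \<Longrightarrow> var i \<in> Rpoly n"
  by (simp add: Rpoly_iff var_def)

lemma Rpoly_uminus: "p \<in> Rpoly n \<Longrightarrow> - p \<in> Rpoly n"
  by (simp add: Rpoly_iff in_keys_iff)

lemma Rpoly_sum: "(\<And>i. i \<in> S \<Longrightarrow> f i \<in> Rpoly n) \<Longrightarrow> sum f S \<in> Rpoly n"
  by (induction S rule: infinite_finite_induct) (auto simp: Rpoly_zero Rpoly_add)

lemma Rdeg_mult: "p \<in> Rdeg n d \<Longrightarrow> q \<in> Rdeg n e \<Longrightarrow> p * q \<in> Rdeg n (d + e)"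
  unfolding Rdeg_iff using keys_mult[of p q] monoms_add by blast

lemma Rdeg_var: "i < n \<Longrightarrow> var i \<in> Rdeg n 1"
  using single_in_monoms[of i n] by (simp add: Rdeg_iff var_def)

lemma subspace_Rdeg: "mp.subspace (Rdeg n d :: 'k::field mpoly set)"
proof (rule mp.subspaceI)
  fix p q :: "'k mpoly" and c
  show "const c * p \<in> Rdeg n d" if "p \<in> Rdeg n d"
    using that by (auto simp: Rdeg_iff in_keys_iff lookup_const_mult)
  show "p + q \<in> Rdeg n d" if "p \<in> Rdeg n d" "q \<in> Rdeg n d"
    using that keys_add[of p q] unfolding Rdeg_iff by blast
qed (simp add: Rdeg_iff)

lemma Rdeg_eq_span: "(Rdeg n d :: 'k::field mpoly set) = mp.span ((\<lambda>m. Poly_Mapping.single m 1) ` monoms n d)"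
proof
  show "mp.span ((\<lambda>m. Poly_Mapping.single m 1) ` monoms n d) \<subseteq> (Rdeg n d :: 'k mpoly set)"
    by (rule mp.span_minimal[OF _ subspace_Rdeg]) (auto simp: Rdeg_iff)
  show "(Rdeg n d :: 'k mpoly set) \<subseteq> mp.span ((\<lambda>m. Poly_Mapping.single m 1) ` monoms n d)"
  proof
    fix p :: "'k mpoly" assume p: "p \<in> Rdeg n d"
    have "(\<Sum>m\<in>Poly_Mapping.keys p. const (Poly_Mapping.lookup p m) * Poly_Mapping.single m 1)
        \<in> mp.span ((\<lambda>m. Poly_Mapping.single m 1) ` monoms n d)"
      using p by (intro mp.span_sum mp.span_scale mp.span_base) (auto simp: Rdeg_iff)
    then show "p \<in> mp.span ((\<lambda>m. Poly_Mapping.single m 1) ` monoms n d)"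
      using poly_mapping_sum_single[of p] by (simp add: const_single)
  qed
qed

lemma fin_dim_Rdeg: "mp.fin_dim (Rdeg n d)"
  unfolding mp.fin_dim_def Rdeg_eq_span using finite_monoms by blast

lemma lookup_hcomp: "Poly_Mapping.lookup (hcomp d p) m = (if mdeg m = d then Poly_Mapping.lookup p m else 0)"
  by (auto simp: hcomp_def lookup_mapp in_keys_iff when_def)

lemma hcomp_add: "hcomp d (p + q) = hcomp d p + hcomp d q"
  by (rule poly_mapping_eqI) (simp add: lookup_hcomp lookup_add)

lemma hcomp_zero: "hcomp d 0 = 0"
  by (rule poly_mapping_eqI) (simp add: lookup_hcomp)

lemma hcomp_diff: "hcomp d (p - q) = hcomp d p - hcomp d q"
  by (rule poly_mapping_eqI) (simp add: lookup_hcomp lookup_minus)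

lemma hcomp_sum: "hcomp d (sum f S) = (\<Sum>i\<in>S. hcomp d (f i))"
  by (induction S rule: infinite_finite_induct) (auto simp: hcomp_zero hcomp_add)

lemma hcomp_Rdeg: "p \<in> Rpoly n \<Longrightarrow> hcomp d p \<in> Rdeg n d"
  by (auto simp: Rdeg_iff Rpoly_iff monoms_def in_keys_iff lookup_hcomp split: if_splits)

lemma hcomp_of_Rdeg: "p \<in> Rdeg n e \<Longrightarrow> hcomp d p = (if d = e then p else 0)"
  by (rule poly_mapping_eqI) (auto simp: lookup_hcomp Rdeg_iff monoms_def in_keys_iff)

lemma hcomp_decomp: "p = (\<Sum>d\<in>mdeg ` Poly_Mapping.keys p. hcomp d p)"
  by (rule poly_mapping_eqI) (auto simp: lookup_sum lookup_hcomp sum.delta in_keys_iff)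

lemma hcomp_mult:
  assumes q: "q \<in> Rdeg n e" and p: "p \<in> Rpoly n"
  shows "hcomp (d + e) (q * p) = q * hcomp d p"
proof -
  \<comment> \<open>Including \<open>d\<close> lets the final sum pick out the term k = d even if
    \<open>p\<close> has no component of that degree.\<close>
  let ?S = "insert d (mdeg ` Poly_Mapping.keys p)"
  have "p = (\<Sum>k\<in>?S. hcomp k p)"
    by (rule poly_mapping_eqI) (auto simp: lookup_sum lookup_hcomp sum.delta in_keys_iff)
  then have "q * p = (\<Sum>k\<in>?S. q * hcomp k p)" by (metis sum_distrib_left)
  then have "hcomp (d + e) (q * p) = (\<Sum>k\<in>?S. hcomp (d + e) (q * hcomp k p))" by (simp only: hcomp_sum)
  also have "\<dots> = (\<Sum>k\<in>?S. if d = k then q * hcomp k p else 0)"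
  proof (rule sum.cong)
    fix k
    have "q * hcomp k p \<in> Rdeg n (e + k)" using q p by (intro Rdeg_mult hcomp_Rdeg)
    then show "hcomp (d + e) (q * hcomp k p) = (if d = k then q * hcomp k p else 0)"
      by (subst hcomp_of_Rdeg) (auto simp: add.commute)
  qed simp
  also have "\<dots> = q * hcomp d p" by (subst sum.delta') auto
  finally show ?thesis .
qed

text \<open>Choose for each monomial of \<open>g\<close> a variable dividing it and collect the
  quotients by variable. In this form generation in degree one enters.\<close>

lemma Rdeg_Suc_decomp:
  assumes "g \<in> Rdeg n (Suc d)"
  obtains f where "\<And>i. i < n \<Longrightarrow> f i \<in> Rdeg n d" "g = (\<Sum>i<n. var i * f i)"
proof -
  have "\<forall>m\<in>Poly_Mapping.keys g. \<exists>i m'. i < n \<and> m' \<in> monoms n d \<and> m = Poly_Mapping.single i 1 + m'"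
    using assms monoms_Suc_split unfolding Rdeg_iff by (metis subset_iff)
  then obtain I M where IM: "\<And>m. m \<in> Poly_Mapping.keys g \<Longrightarrow>
      I m < n \<and> M m \<in> monoms n d \<and> m = Poly_Mapping.single (I m) 1 + M m" by metis
  define f where "f i = (\<Sum>m\<in>{m \<in> Poly_Mapping.keys g. I m = i}. Poly_Mapping.single (M m) (Poly_Mapping.lookup g m))" for i
  have "f i \<in> Rdeg n d" if "i < n" for i
  proof -
    have "Poly_Mapping.keys (f i) \<subseteq> (\<Union>m\<in>{m \<in> Poly_Mapping.keys g. I m = i}. Poly_Mapping.keys (Poly_Mapping.single (M m) (Poly_Mapping.lookup g m)))"
      unfolding f_def by (rule keys_sum)
    also have "\<dots> \<subseteq> monoms n d" using IM by auto
    finally show ?thesis by (simp add: Rdeg_iff)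
  qed
  moreover have "g = (\<Sum>i<n. var i * f i)"
  proof -
    have "(\<Sum>i<n. var i * f i) = (\<Sum>i<n. \<Sum>m\<in>{m \<in> Poly_Mapping.keys g. I m = i}. Poly_Mapping.single m (Poly_Mapping.lookup g m))"
      unfolding f_def sum_distrib_left
    proof (intro sum.cong refl)
      fix i m assume "m \<in> {m \<in> Poly_Mapping.keys g. I m = i}"
      then have "m = Poly_Mapping.single i 1 + M m" using IM by auto
      then show "var i * Poly_Mapping.single (M m) (Poly_Mapping.lookup g m) = Poly_Mapping.single m (Poly_Mapping.lookup g m)"
        by (metis mult_1 mult_single var_def)
    qed
    also have "\<dots> = (\<Sum>m\<in>Poly_Mapping.keys g. Poly_Mapping.single m (Poly_Mapping.lookup g m))"
      by (rule sum.group) (use IM in auto)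
    finally show ?thesis using poly_mapping_sum_single by metis
  qed
  ultimately show thesis by (rule that)
qed

lemma monoms_1: "monoms n 1 = (\<lambda>i. Poly_Mapping.single i 1) ` {..<n}"
proof
  show "(\<lambda>i. Poly_Mapping.single i 1) ` {..<n} \<subseteq> monoms n 1" using single_in_monoms by blast
  show "monoms n 1 \<subseteq> (\<lambda>i. Poly_Mapping.single i 1) ` {..<n}"
  proof
    fix m assume "m \<in> monoms n 1"
    then obtain i m' where "i < n" "m' \<in> monoms n 0" "m = Poly_Mapping.single i 1 + m'"
      using monoms_Suc_split[of m n 0] by (metis One_nat_def)
    then show "m \<in> (\<lambda>i. Poly_Mapping.single i 1) ` {..<n}" by (simp add: monoms_0)
  qed
qed

lemma Rdeg_1_linform:
  assumes "L \<in> Rdeg n 1"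
  obtains a where "L = linform n a"
proof -
  let ?e = "\<lambda>i. Poly_Mapping.single i (1::nat)"
  have inj: "inj_on ?e {..<n}" by (rule inj_onI) (metis lookup_single_eq lookup_single_not_eq zero_neq_one)
  have "L = (\<Sum>m\<in>Poly_Mapping.keys L. Poly_Mapping.single m (Poly_Mapping.lookup L m))"
    by (rule poly_mapping_sum_single)
  also have "\<dots> = (\<Sum>m\<in>monoms n 1. Poly_Mapping.single m (Poly_Mapping.lookup L m))"
    by (rule sum.mono_neutral_left) (use assms in \<open>auto simp: finite_monoms Rdeg_iff in_keys_iff\<close>)
  also have "\<dots> = (\<Sum>i<n. Poly_Mapping.single (?e i) (Poly_Mapping.lookup L (?e i)))"
    unfolding monoms_1 by (subst sum.reindex[OF inj]) simp
  also have "\<dots> = linform n (\<lambda>i. Poly_Mapping.lookup L (?e i))"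
    unfolding linform_def var_def const_single by simp
  finally show thesis by (rule that)
qed

lemma linform_Rdeg: "linform n (a :: nat \<Rightarrow> 'k::field) \<in> Rdeg n 1"
  unfolding linform_def using subspace_Rdeg
  by (intro mp.subspace_sum[OF subspace_Rdeg] mp.subspace_scale[OF subspace_Rdeg] Rdeg_var) simp

section \<open>Graded quotients\<close>

lemma linear_mult: "Vector_Spaces.linear (\<lambda>(c::'k::field) p. const c * p) (\<lambda>c p. const c * p) (\<lambda>p. q * p)"
  by unfold_locales (simp_all add: algebra_simps)

text \<open>Models A = R/I inside the polynomials: \<open>\<pi> p\<close> represents the residue
  class of \<open>p\<close>, and \<open>V d\<close> is the part of degree \<open>d\<close>. The map
  need not preserve degrees or products, so \<open>mul\<close> reduces each product again.\<close>

locale graded_quotient =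
  fixes n :: nat and I :: "'k::field mpoly set" and \<pi> :: "'k mpoly \<Rightarrow> 'k mpoly"
  assumes ideal: "hom_ideal n I"
    and linear_pi: "Vector_Spaces.linear (\<lambda>c p. const c * p) (\<lambda>c p. const c * p) \<pi>"
    and pi_eq_0: "\<pi> p = 0 \<longleftrightarrow> p \<in> I"
    and pi_diff: "p - \<pi> p \<in> I"
begin

sublocale pi: Vector_Spaces.linear "\<lambda>c p. const c * p" "\<lambda>c p. const c * p" \<pi>
  by (fact linear_pi)

lemma ideal_Rpoly: "p \<in> I \<Longrightarrow> p \<in> Rpoly n"
  and ideal_zero: "0 \<in> I"
  and ideal_add: "p \<in> I \<Longrightarrow> q \<in> I \<Longrightarrow> p + q \<in> I"
  and ideal_mult: "r \<in> Rpoly n \<Longrightarrow> p \<in> I \<Longrightarrow> r * p \<in> I"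
  and ideal_hcomp: "p \<in> I \<Longrightarrow> hcomp d p \<in> I"
  using ideal by (auto simp: hom_ideal_def)

lemma ideal_uminus: "p \<in> I \<Longrightarrow> - p \<in> I"
  using ideal_mult[OF Rpoly_const, of p "-1"] by (simp add: const_def single_uminus)

lemma ideal_sum: "(\<And>i. i \<in> S \<Longrightarrow> f i \<in> I) \<Longrightarrow> sum f S \<in> I"
  by (induction S rule: infinite_finite_induct) (auto simp: ideal_zero ideal_add)

lemma pi_eq_iff: "\<pi> p = \<pi> q \<longleftrightarrow> p - q \<in> I"
  using pi_eq_0[of "p - q"] by (simp add: pi.diff)

lemma pi_mult: "q \<in> Rpoly n \<Longrightarrow> \<pi> (q * \<pi> p) = \<pi> (q * p)"
  using ideal_uminus[OF ideal_mult[OF _ pi_diff[of p], of q]]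
  by (simp add: pi_eq_iff right_diff_distrib)

definition V :: "nat \<Rightarrow> 'k mpoly set" where
  "V d = \<pi> ` Rdeg n d"

lemma subspace_V: "mp.subspace (V d)"
  unfolding V_def by (rule pi.subspace_image[OF subspace_Rdeg])

lemma fin_dim_V: "mp.fin_dim (V d)"
  unfolding V_def by (rule mp.rank_nullity(2)[OF linear_pi subspace_Rdeg fin_dim_Rdeg])

lemma indep_mod_iff:
  "indep_mod I S \<longleftrightarrow> finite S \<and> inj_on \<pi> S \<and> mp.independent (\<pi> ` S)"
proof (intro iffI conjI)
  assume S: "indep_mod I S"
  then show fin: "finite S" by (simp add: indep_mod_def)
  have 0: "\<forall>s\<in>S. c s = 0" if "(\<Sum>s\<in>S. const (c s) * \<pi> s) = 0" for c
  proof -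
    have "\<pi> (\<Sum>s\<in>S. const (c s) * s) = 0" using that by (simp add: pi.sum pi.scale)
    then show ?thesis using S by (simp add: indep_mod_def pi_eq_0)
  qed
  show inj: "inj_on \<pi> S"
  proof (rule inj_onI, rule ccontr)
    fix s t assume st: "s \<in> S" "t \<in> S" "\<pi> s = \<pi> t" "s \<noteq> t"
    \<comment> \<open>Coefficients 1 and -1 at two congruent elements give a relation modulo
      \<open>I\<close>.\<close>
    define c where "c u = (if u = s then 1 else if u = t then -1 else 0 :: 'k)" for u
    have "(\<Sum>u\<in>S. const (c u) * \<pi> u) = (\<Sum>u\<in>{s, t}. const (c u) * \<pi> u)"
      using fin st by (intro sum.mono_neutral_right) (auto simp: c_def const_simps)
    also have "\<dots> = 0" using st by (simp add: c_def const_def single_uminus)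
    finally have "c s = 0" using 0 st(1) by blast
    then show False by (simp add: c_def)
  qed
  show "mp.independent (\<pi> ` S)"
  proof (rule mp.independent_if_scalars_zero)
    fix f v assume f: "(\<Sum>v\<in>\<pi> ` S. const (f v) * v) = 0" and v: "v \<in> \<pi> ` S"
    have "(\<Sum>s\<in>S. const (f (\<pi> s)) * \<pi> s) = 0" using f by (simp add: sum.reindex[OF inj])
    then show "f v = 0" using 0[of "\<lambda>s. f (\<pi> s)"] v by blast
  qed (use fin in simp)
next
  assume S: "finite S \<and> inj_on \<pi> S \<and> mp.independent (\<pi> ` S)"
  then have inj: "inj_on \<pi> S" by blast
  have "c s = 0" if c: "(\<Sum>s\<in>S. const (c s) * s) \<in> I" and s: "s \<in> S" for c s
  proof -
    have "(\<Sum>s\<in>S. const (c s) * \<pi> s) = 0"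
      using c by (simp add: pi_eq_0[symmetric] pi.sum pi.scale)
    then have "(\<Sum>v\<in>\<pi> ` S. const (c (the_inv_into S \<pi> v)) * v) = 0"
      by (simp add: sum.reindex[OF inj] the_inv_into_f_f[OF inj])
    then have "c (the_inv_into S \<pi> (\<pi> s)) = 0"
      using mp.independentD[of "\<pi> ` S" "\<pi> ` S" "\<lambda>v. c (the_inv_into S \<pi> v)"] S s by blast
    then show ?thesis using the_inv_into_f_f[OF inj s] by simp
  qed
  then show "indep_mod I S" using S by (auto simp: indep_mod_def)
qed

text \<open>Independent sets modulo \<open>I\<close> map injectively to independent sets in
  \<open>V d\<close>, so their sizes are bounded and the maximum in \<open>hilb\<close> is over a
  finite set. Lifting a basis of \<open>V d\<close> attains it.\<close>

lemma hilb_eq_dim: "hilb n I d = mp.dim (V d)"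
  unfolding hilb_def
proof (rule Max_eqI)
  have le: "card S \<le> mp.dim (V d)" if "S \<subseteq> Rdeg n d" "indep_mod I S" for S
  proof -
    have "card (\<pi> ` S) \<le> mp.dim (V d)"
      using that by (intro mp.independent_card_le_dim[OF fin_dim_V]) (auto simp: indep_mod_iff V_def)
    then show ?thesis using that by (simp add: indep_mod_iff card_image)
  qed
  then have "{card S |S. S \<subseteq> Rdeg n d \<and> indep_mod I S} \<subseteq> {..mp.dim (V d)}" by blast
  then show "finite {card S |S. S \<subseteq> Rdeg n d \<and> indep_mod I S}" by (rule finite_subset) simp
  show "y \<le> mp.dim (V d)" if "y \<in> {card S |S. S \<subseteq> Rdeg n d \<and> indep_mod I S}" for y
    using that le by blast
  obtain B where B: "B \<subseteq> V d" "mp.independent B" "card B = mp.dim (V d)" "finite B"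
    using mp.fin_dim_basis[OF fin_dim_V] by metis
  then obtain S where S: "S \<subseteq> Rdeg n d" "inj_on \<pi> S" "B = \<pi> ` S"
    unfolding V_def subset_image_inj by blast
  then have "indep_mod I S" using B by (simp add: indep_mod_iff finite_image_iff)
  moreover have "card S = mp.dim (V d)" using S B by (simp add: card_image)
  ultimately show "mp.dim (V d) \<in> {card S |S. S \<subseteq> Rdeg n d \<and> indep_mod I S}"
    using S(1) by (intro CollectI exI[of _ S]) simp
qed

lemma hilb_eq_0_iff: "hilb n I d = 0 \<longleftrightarrow> Rdeg n d \<subseteq> I"
  unfolding hilb_eq_dim mp.dim_zero_iff[OF fin_dim_V] by (auto simp: V_def pi_eq_0)

section \<open>Multiplication by linear forms\<close>

definition mul :: "'k mpoly \<Rightarrow> 'k mpoly \<Rightarrow> 'k mpoly" where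
  "mul L v = \<pi> (L * v)"

definition rank :: "'k mpoly \<Rightarrow> nat \<Rightarrow> nat" where
  "rank L d = mp.dim (mul L ` V d)"

lemma linear_mul: "Vector_Spaces.linear (\<lambda>c p. const c * p) (\<lambda>c p. const c * p) (mul L)"
  using Vector_Spaces.linear_compose[OF linear_mult linear_pi, of L] by (simp add: mul_def[abs_def] o_def)

lemma mul_pi: "L \<in> Rpoly n \<Longrightarrow> mul L (\<pi> f) = \<pi> (L * f)"
  by (simp add: mul_def pi_mult)

lemma mul_V: "L \<in> Rdeg n 1 \<Longrightarrow> mul L ` V d \<subseteq> V (Suc d)"
  using Rdeg_mult[of L n 1] Rdeg_subset_Rpoly[of n 1] by (auto simp: V_def mul_pi)

lemma kernel_dim: "hilb n I d = mp.dim {v \<in> V d. mul L v = 0} + rank L d"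
  unfolding hilb_eq_dim rank_def
  by (rule mp.rank_nullity(1)[OF linear_mul subspace_V fin_dim_V])

lemma rank_le:
  assumes "L \<in> Rdeg n 1"
  shows "rank L d \<le> hilb n I d" "rank L d \<le> hilb n I (Suc d)"
  using kernel_dim[of d L] mp.fin_dim_mono[OF fin_dim_V mul_V[OF assms]]
  by (auto simp: rank_def hilb_eq_dim)

text \<open>With \<open>rank_surj\<close>, this expresses the two alternatives in \<open>WLP\<close>
  as the two extreme values of the rank.\<close>

lemma rank_inj:
  assumes L: "L \<in> Rdeg n 1"
  shows "rank L d = hilb n I d \<longleftrightarrow> (\<forall>f\<in>Rdeg n d. L * f \<in> I \<longrightarrow> f \<in> I)"
proof -
  have "L \<in> Rpoly n" using L Rdeg_subset_Rpoly by blast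
  then have "(\<forall>f\<in>Rdeg n d. L * f \<in> I \<longrightarrow> f \<in> I) \<longleftrightarrow> {v \<in> V d. mul L v = 0} \<subseteq> {0}"
    by (auto simp: V_def mul_pi pi_eq_0)
  also have "\<dots> \<longleftrightarrow> mp.dim {v \<in> V d. mul L v = 0} = 0"
    by (rule mp.dim_zero_iff[symmetric], rule mp.fin_dim_subset[OF fin_dim_V]) blast
  finally show ?thesis using kernel_dim[of d L] by auto
qed

lemma rank_surj:
  assumes L: "L \<in> Rdeg n 1"
  shows "rank L d = hilb n I (Suc d) \<longleftrightarrow> (\<forall>g\<in>Rdeg n (Suc d). \<exists>f\<in>Rdeg n d. g - L * f \<in> I)"
proof -
  interpret mul: Vector_Spaces.linear "\<lambda>c p. const c * p" "\<lambda>c p. const c * p" "mul L"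
    by (fact linear_mul)
  have LR: "L \<in> Rpoly n" using L Rdeg_subset_Rpoly by blast
  have "(\<forall>g\<in>Rdeg n (Suc d). \<exists>f\<in>Rdeg n d. g - L * f \<in> I) \<longleftrightarrow> V (Suc d) \<subseteq> mul L ` V d"
    unfolding V_def image_image mul_pi[OF LR] by (auto simp: pi_eq_iff[symmetric] image_iff)
  also have "\<dots> \<longleftrightarrow> mp.dim (mul L ` V d) = mp.dim (V (Suc d))"
  proof
    assume "V (Suc d) \<subseteq> mul L ` V d"
    then show "mp.dim (mul L ` V d) = mp.dim (V (Suc d))" using mul_V[OF L] by (metis antisym)
  next
    assume "mp.dim (mul L ` V d) = mp.dim (V (Suc d))"
    then have "mul L ` V d = V (Suc d)"
      by (intro mp.fin_dim_eq[OF fin_dim_V] mul.subspace_image subspace_V mul_V[OF L]) simp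
    then show "V (Suc d) \<subseteq> mul L ` V d" by simp
  qed
  finally show ?thesis by (simp add: rank_def hilb_eq_dim)
qed

text \<open>Taking the component of degree d + 1 of g - L f replaces \<open>f\<close> by its
  component of degree \<open>d\<close>. This reconciles \<open>redn\<close>, which allows any
  \<open>f\<close> in R, with \<open>WLP\<close>.\<close>

lemma surj_Rpoly_iff:
  assumes L: "L \<in> Rdeg n 1"
  shows "(\<forall>g\<in>Rdeg n (Suc d). \<exists>f\<in>Rpoly n. g - L * f \<in> I)
    \<longleftrightarrow> (\<forall>g\<in>Rdeg n (Suc d). \<exists>f\<in>Rdeg n d. g - L * f \<in> I)"
proof (intro iffI ballI)
  fix g :: "'k mpoly"
  assume g: "g \<in> Rdeg n (Suc d)" and "\<forall>g\<in>Rdeg n (Suc d). \<exists>f\<in>Rpoly n. g - L * f \<in> I"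
  then obtain f where f: "f \<in> Rpoly n" "g - L * f \<in> I" by blast
  have "hcomp (Suc d) (g - L * f) = g - L * hcomp d f"
    using hcomp_of_Rdeg[OF g] hcomp_mult[OF L f(1), of d] by (simp add: hcomp_diff)
  then show "\<exists>f\<in>Rdeg n d. g - L * f \<in> I"
    using ideal_hcomp[OF f(2), of "Suc d"] hcomp_Rdeg[OF f(1)] by auto
qed (use Rdeg_subset_Rpoly in blast)

text \<open>Write \<open>g\<close> as the sum of the x_i u_i and lift each u_i.\<close>

lemma surj_Suc:
  assumes L: "L \<in> Rdeg n 1" and s: "\<forall>g\<in>Rdeg n (Suc d). \<exists>f\<in>Rpoly n. g - L * f \<in> I"
  shows "\<forall>g\<in>Rdeg n (Suc (Suc d)). \<exists>f\<in>Rpoly n. g - L * f \<in> I"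
proof
  fix g :: "'k mpoly" assume "g \<in> Rdeg n (Suc (Suc d))"
  then obtain u where u: "\<And>i. i < n \<Longrightarrow> u i \<in> Rdeg n (Suc d)" "g = (\<Sum>i<n. var i * u i)"
    using Rdeg_Suc_decomp by blast
  then have "\<forall>i\<in>{..<n}. \<exists>f. f \<in> Rpoly n \<and> u i - L * f \<in> I" using s by blast
  then obtain f where "\<forall>i\<in>{..<n}. f i \<in> Rpoly n \<and> u i - L * f i \<in> I"
    by (rule bchoice[THEN exE])
  then have f: "f i \<in> Rpoly n" "u i - L * f i \<in> I" if "i < n" for i using that by auto
  have "g - L * (\<Sum>i<n. var i * f i) = (\<Sum>i<n. var i * (u i - L * f i))"
    by (simp add: u(2) sum_distrib_left sum_subtractf algebra_simps)
  also have "\<dots> \<in> I" using f by (intro ideal_sum ideal_mult Rpoly_var) auto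
  finally show "\<exists>f\<in>Rpoly n. g - L * f \<in> I"
    using f by (intro bexI[of _ "\<Sum>i<n. var i * f i"] Rpoly_sum Rpoly_mult Rpoly_var) auto
qed

text \<open>By \<open>surj_Suc\<close> the degrees of surjectivity are closed upwards, so the least
  one determines them all; \<open>ex\<close> ensures that it exists.\<close>

lemma redn_le_iff:
  assumes L: "L \<in> Rdeg n 1" and ex: "\<exists>d. rank L d = hilb n I (Suc d)"
  shows "redn n I L \<le> d \<longleftrightarrow> rank L d = hilb n I (Suc d)"
proof -
  define P where "P d \<longleftrightarrow> (\<forall>g\<in>Rdeg n (Suc d). \<exists>f\<in>Rpoly n. g - L * f \<in> I)" for d
  have P: "P d \<longleftrightarrow> rank L d = hilb n I (Suc d)" for d
    unfolding P_def rank_surj[OF L] by (rule surj_Rpoly_iff[OF L])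
  have r: "redn n I L = (LEAST d. P d)" by (simp add: redn_def P_def)
  have step: "P d \<Longrightarrow> P (Suc d)" for d unfolding P_def by (rule surj_Suc[OF L])
  have PR: "P (redn n I L)" unfolding r by (rule LeastI_ex) (use ex P in blast)
  have "P d" if "redn n I L \<le> d"
    using that by (induction d rule: dec_induct) (use PR step in blast)+
  moreover have "P d \<Longrightarrow> redn n I L \<le> d" unfolding r by (rule Least_le)
  ultimately show ?thesis unfolding P[symmetric] by blast
qed

text \<open>\<open>B d\<close> consists of the standard monomials. A relation expressing
  \<open>m\<close> by smaller monomials modulo \<open>I\<close> may be multiplied by a variable, and
  the order on exponent vectors is invariant under translation; hence divisors of standard monomials
  are standard.\<close>

lemma monomial_basis:
  defines "v \<equiv> \<lambda>m. \<pi> (Poly_Mapping.single m 1)"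
  defines "B \<equiv> \<lambda>d. {m \<in> monoms n d. v m \<notin> mp.span (v ` {m' \<in> monoms n d. m' < m})}"
  shows "card (B d) = hilb n I d"
    and "\<And>m i. i < n \<Longrightarrow> m + Poly_Mapping.single i 1 \<in> B (Suc d) \<Longrightarrow> m \<in> B d"
proof -
  have img: "v ` M = \<pi> ` ((\<lambda>m. Poly_Mapping.single m 1) ` M)" for M by (auto simp: v_def)
  have span: "mp.span (v ` monoms n d) = V d"
    unfolding img V_def Rdeg_eq_span by (rule pi.span_image)
  have "card (B d) = mp.dim (v ` monoms n d)"
    unfolding B_def by (rule mp.greedy_basis[OF finite_monoms])
  also have "\<dots> = mp.dim (mp.span (v ` monoms n d))" by (rule mp.dim_span[symmetric])
  finally show "card (B d) = hilb n I d" unfolding span hilb_eq_dim .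
  fix m i assume i: "i < n" and m: "m + Poly_Mapping.single i 1 \<in> B (Suc d)"
  let ?e = "Poly_Mapping.single i (1::nat)"
  interpret mul: Vector_Spaces.linear "\<lambda>c p. const c * p" "\<lambda>c p. const c * p" "mul (var i)"
    by (fact linear_mul)
  have mulv: "mul (var i) (v m) = v (m + ?e)" for m
    using i by (simp add: v_def mul_pi Rpoly_var) (simp add: var_def mult_single add.commute)
  have mM: "m \<in> monoms n d"
    using m by (auto simp: B_def monoms_def mdeg_add mdeg_single keys_add_nat)
  show "m \<in> B d"
  proof (rule ccontr)
    assume "m \<notin> B d"
    then have "v m \<in> mp.span (v ` {m' \<in> monoms n d. m' < m})" using mM by (simp add: B_def)
    then have "mul (var i) (v m) \<in> mp.span (mul (var i) ` v ` {m' \<in> monoms n d. m' < m})"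
      unfolding mul.span_image by blast
    also have "mul (var i) ` v ` {m' \<in> monoms n d. m' < m} = v ` (\<lambda>m. m + ?e) ` {m' \<in> monoms n d. m' < m}"
      by (simp add: image_image mulv)
    also have "mp.span \<dots> \<subseteq> mp.span (v ` {m' \<in> monoms n (Suc d). m' < m + ?e})"
    proof (intro mp.span_mono image_mono image_subsetI)
      fix m' assume "m' \<in> {m' \<in> monoms n d. m' < m}"
      then show "m' + ?e \<in> {m' \<in> monoms n (Suc d). m' < m + ?e}"
        using monoms_add[OF _ single_in_monoms[OF i], of m' d] by (simp add: add_strict_right_mono)
    qed
    finally show False using m by (simp add: B_def mulv)
  qed
qed

theorem macaulay_bound:
  assumes "d \<ge> 1"
  shows "hilb n I (Suc d) \<le> mac_up d (hilb n I d)"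
proof -
  define v where "v m = \<pi> (Poly_Mapping.single m 1)" for m
  define B where "B d = {m \<in> monoms n d. v m \<notin> mp.span (v ` {m' \<in> monoms n d. m' < m})}" for d
  note mb = monomial_basis[folded v_def, folded B_def]
  have BM: "B d \<subseteq> monoms n d" for d by (auto simp: B_def)
  have cardB: "card (exps ` B d) = hilb n I d" for d
    using mb(1)[of d] card_image[OF inj_on_subset[OF inj_exps subset_UNIV], of "B d"] by simp
  have sub: "exps ` B (Suc d) \<subseteq> msets n (Suc d)" using exps_monoms BM by blast
  have "shadow (exps ` B (Suc d)) \<subseteq> exps ` B d"
  proof
    fix N assume "N \<in> shadow (exps ` B (Suc d))"
    then obtain i m where m: "m \<in> B (Suc d)" "add_mset i N = exps m" unfolding shadow_def by blast
    have "i \<in> Poly_Mapping.keys m" using m(2) by (metis set_mset_exps union_single_eq_member)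
    moreover have "Poly_Mapping.keys m \<subseteq> {..<n}" using m(1) BM by (auto simp: monoms_def)
    ultimately have i: "i < n" by blast
    let ?m = "m - Poly_Mapping.single i 1"
    have eq: "m = ?m + Poly_Mapping.single i 1"
      by (rule poly_mapping_eqI)
        (use \<open>i \<in> Poly_Mapping.keys m\<close> in \<open>auto simp: lookup_add lookup_minus lookup_single when_def in_keys_iff\<close>)
    then have "?m \<in> B d" using mb(2)[OF i, of ?m d] m(1) by simp
    moreover have "N = exps ?m" using m(2) eq exps_add_single[of ?m i] by simp
    ultimately show "N \<in> exps ` B d" by blast
  qed
  then have "card (shadow (exps ` B (Suc d))) \<le> hilb n I d"
    using card_mono[of "exps ` B d"] finite_subset[OF BM finite_monoms] cardB[of d] by (metis finite_imageI)
  then have "mac_up d (card (shadow (exps ` B (Suc d)))) \<le> mac_up d (hilb n I d)" by (rule mac_up_mono)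
  then show ?thesis using macaulay_shadow[OF assms sub] cardB[of "Suc d"] by simp
qed

end

lemma exists_graded_quotient:
  assumes I: "hom_ideal n (I :: 'k::field mpoly set)"
  obtains \<pi> where "graded_quotient n I \<pi>"
proof -
  have "mp.subspace I"
  proof (rule mp.subspaceI)
    show "const c * x \<in> I" if "x \<in> I" for c x
      using I that Rpoly_const[of c n] unfolding hom_ideal_def by blast
  qed (use I in \<open>auto simp: hom_ideal_def\<close>)
  then obtain p where "Vector_Spaces.linear (\<lambda>c p. const c * p) (\<lambda>c p. const c * p) p"
    "\<And>x. p x = 0 \<longleftrightarrow> x \<in> I" "\<And>x. x - p x \<in> I" using mp.exists_projection by blast
  then have "graded_quotient n I p" using I by (simp add: graded_quotient_def)
  then show thesis by (rule that)
qed

section \<open>Generic linear forms\<close>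

lemma Rpoly_prod: "(\<And>i. i \<in> S \<Longrightarrow> f i \<in> Rpoly n) \<Longrightarrow> prod f S \<in> Rpoly n"
  using Rpoly_const[of 1 n]
  by (induction S rule: infinite_finite_induct) (auto simp: const_simps Rpoly_mult)

section \<open>Evaluation of polynomials\<close>

definition mon_eval :: "(nat \<Rightarrow> 'k::comm_ring_1) \<Rightarrow> (nat \<Rightarrow>\<^sub>0 nat) \<Rightarrow> 'k" where
  "mon_eval a m = (\<Prod>i\<in>Poly_Mapping.keys m. a i ^ Poly_Mapping.lookup m i)"

lemma mon_eval_superset:
  "finite S \<Longrightarrow> Poly_Mapping.keys m \<subseteq> S \<Longrightarrow> mon_eval a m = (\<Prod>i\<in>S. a i ^ Poly_Mapping.lookup m i)"
  unfolding mon_eval_def by (rule prod.mono_neutral_left) (auto simp: in_keys_iff)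

lemma mon_eval_add: "mon_eval a (m + m') = mon_eval a m * mon_eval a m'"
  by (simp add: mon_eval_superset[of "Poly_Mapping.keys m \<union> Poly_Mapping.keys m'"] keys_add_nat
      lookup_add power_add prod.distrib)

lemma peval_superset:
  assumes "finite S" "Poly_Mapping.keys p \<subseteq> S"
  shows "peval a p = (\<Sum>m\<in>S. Poly_Mapping.lookup p m * mon_eval a m)"
  unfolding peval_def mon_eval_def
  by (rule sum.mono_neutral_left) (use assms in \<open>auto simp: in_keys_iff\<close>)

lemma peval_single: "peval a (Poly_Mapping.single m c) = c * mon_eval a m"
  by (subst peval_superset[of "{m}"]) auto

lemma peval_add: "peval a (p + q) = peval a p + peval a q"
proof -
  let ?S = "Poly_Mapping.keys p \<union> Poly_Mapping.keys q"
  have "Poly_Mapping.keys (p + q) \<subseteq> ?S" by (rule keys_add)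
  then show ?thesis
    by (simp add: peval_superset[of ?S] lookup_add distrib_right sum.distrib)
qed

lemma peval_zero: "peval a 0 = 0"
  by (simp add: peval_def)

lemma peval_sum: "peval a (sum f S) = (\<Sum>i\<in>S. peval a (f i))"
  by (induction S rule: infinite_finite_induct) (auto simp: peval_zero peval_add)

lemma peval_mult: "peval a (p * q) = peval a p * peval a q"
proof -
  let ?s = "\<lambda>p m. Poly_Mapping.single m (Poly_Mapping.lookup p m)"
  have "p * q = (\<Sum>m\<in>Poly_Mapping.keys p. ?s p m) * (\<Sum>m\<in>Poly_Mapping.keys q. ?s q m)"
    using poly_mapping_sum_single[of p] poly_mapping_sum_single[of q] by simp
  then have "peval a (p * q) = (\<Sum>m\<in>Poly_Mapping.keys p. \<Sum>m'\<in>Poly_Mapping.keys q. peval a (?s p m) * peval a (?s q m'))"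
    by (simp add: sum_product peval_sum mult_single peval_single mon_eval_add mult_ac)
  also have "\<dots> = peval a (\<Sum>m\<in>Poly_Mapping.keys p. ?s p m) * peval a (\<Sum>m\<in>Poly_Mapping.keys q. ?s q m)"
    by (simp add: sum_product peval_sum)
  finally show ?thesis
    using poly_mapping_sum_single[of p] poly_mapping_sum_single[of q] by simp
qed

lemma peval_const: "peval a (const c) = c"
  by (simp add: const_def peval_single mon_eval_def)

lemma peval_one: "peval a 1 = 1"
  using peval_const[of a 1] by (simp add: const_simps)

lemma peval_var: "peval a (var i) = a i"
  by (simp add: var_def peval_single mon_eval_def)

lemma peval_hom: "comm_ring_hom (peval a)"
  by unfold_locales (simp_all add: peval_add peval_mult peval_zero peval_one)

text \<open>Distinct monomials get distinct exponents under the substitution $x_i \mapsto u^{t^i}$ for a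
suitable $t$, because a nonzero integer polynomial has finitely many roots.\<close>

lemma exists_separating_weight:
  assumes "finite S"
  obtains t :: nat where "inj_on (\<lambda>m. \<Sum>i\<in>Poly_Mapping.keys m. Poly_Mapping.lookup m i * t ^ i) S"
proof -
  define q :: "(nat \<Rightarrow>\<^sub>0 nat) \<Rightarrow> int poly" where
    "q m = (\<Sum>i\<in>Poly_Mapping.keys m. Polynomial.monom (int (Poly_Mapping.lookup m i)) i)" for m
  have coeff: "Polynomial.coeff (q m) i = int (Poly_Mapping.lookup m i)" for m i
    by (auto simp: q_def Polynomial.coeff_sum sum.delta in_keys_iff)
  have inj: "m = m'" if "q m = q m'" for m m'
    by (rule poly_mapping_eqI) (metis coeff of_nat_eq_iff that)
  have pq: "poly (q m) (int t) = int (\<Sum>i\<in>Poly_Mapping.keys m. Poly_Mapping.lookup m i * t ^ i)" for m t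
    by (simp add: q_def poly_sum poly_monom)
  define Z where "Z = (\<Union>(m, m')\<in>{(m, m') \<in> S \<times> S. m \<noteq> m'}. {x. poly (q m - q m') x = 0})"
  have "finite Z"
    unfolding Z_def
  proof (rule finite_UN_I)
    show "finite {(m, m') \<in> S \<times> S. m \<noteq> m'}"
      by (rule finite_subset[of _ "S \<times> S"]) (use assms in auto)
    fix p assume "p \<in> {(m, m') \<in> S \<times> S. m \<noteq> m'}"
    then have "q (fst p) - q (snd p) \<noteq> 0" using inj[of "fst p" "snd p"] by auto
    then show "finite (case p of (m, m') \<Rightarrow> {x. poly (q m - q m') x = 0})"
      unfolding case_prod_unfold by (rule poly_roots_finite)
  qed
  moreover have "infinite (range int)" by (simp add: range_inj_infinite)
  ultimately obtain t where t: "int t \<notin> Z"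
    by (metis finite_subset image_subsetI)
  have "inj_on (\<lambda>m. \<Sum>i\<in>Poly_Mapping.keys m. Poly_Mapping.lookup m i * t ^ i) S"
  proof (rule inj_onI, rule ccontr)
    fix m m' assume m: "m \<in> S" "m' \<in> S" "m \<noteq> m'"
      and "(\<Sum>i\<in>Poly_Mapping.keys m. Poly_Mapping.lookup m i * t ^ i)
        = (\<Sum>i\<in>Poly_Mapping.keys m'. Poly_Mapping.lookup m' i * t ^ i)"
    then have "poly (q m - q m') (int t) = 0" by (simp add: pq)
    then have "int t \<in> Z" unfolding Z_def using m by blast
    then show False using t by simp
  qed
  then show thesis by (rule that)
qed

lemma exists_nonroot:
  fixes P :: "'k::field_char_0 mpoly"
  assumes "P \<noteq> 0"
  obtains a where "peval a P \<noteq> 0"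
proof -
  obtain t where t: "inj_on (\<lambda>m. \<Sum>i\<in>Poly_Mapping.keys m. Poly_Mapping.lookup m i * t ^ i) (Poly_Mapping.keys P)"
    using exists_separating_weight[OF finite_keys] by blast
  define W where "W m = (\<Sum>i\<in>Poly_Mapping.keys m. Poly_Mapping.lookup m i * t ^ i)" for m :: "nat \<Rightarrow>\<^sub>0 nat"
  \<comment> \<open>\<open>Q\<close> is the image of \<open>P\<close> under the substitution of
    u^(t^i) for x_i. As \<open>W\<close> is injective on the monomials of \<open>P\<close>, no
    coefficients cancel.\<close>
  define Q where "Q = (\<Sum>m\<in>Poly_Mapping.keys P. Polynomial.monom (Poly_Mapping.lookup P m) (W m))"
  have inj: "inj_on W (Poly_Mapping.keys P)" using t by (simp add: W_def[abs_def])
  obtain m where m: "m \<in> Poly_Mapping.keys P" using assms by (metis keys_eq_empty ex_in_conv)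
  have "Polynomial.coeff Q (W m) = (\<Sum>m'\<in>Poly_Mapping.keys P. if m = m' then Poly_Mapping.lookup P m' else 0)"
    unfolding Q_def Polynomial.coeff_sum Polynomial.coeff_monom
    by (rule sum.cong) (use inj m in \<open>auto simp: inj_on_eq_iff\<close>)
  also have "\<dots> = Poly_Mapping.lookup P m" using m by (simp add: sum.delta')
  finally have "Q \<noteq> 0" using m by (auto simp: in_keys_iff)
  then have "finite {u. poly Q u = 0}" by (rule poly_roots_finite)
  then obtain u where u: "poly Q u \<noteq> 0"
    using infinite_UNIV_char_0[where 'a = 'k] by (metis (mono_tags, lifting) UNIV_eq_I mem_Collect_eq)
  have "mon_eval (\<lambda>i. u ^ (t ^ i)) m = u ^ W m" for m
    unfolding mon_eval_def W_def power_sum by (simp add: power_mult[symmetric] mult.commute)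
  then have "peval (\<lambda>i. u ^ (t ^ i)) P = poly Q u"
    unfolding Q_def by (simp add: peval_superset[OF finite_keys subset_refl] poly_sum poly_monom)
  then show thesis using u that by metis
qed

text \<open>Two nonempty open sets meet, since the product of their defining polynomials is nonzero
  and has a nonroot. Hence the generic value is unique.\<close>

lemma r1_eqI:
  fixes I :: "'k::field_char_0 mpoly set"
  assumes P: "P \<in> Rpoly n" "P \<noteq> 0" "\<And>a. peval a P \<noteq> 0 \<Longrightarrow> redn n I (linform n a) = r"
  shows "r1 n I = r"
  unfolding r1_def
proof (rule the_equality)
  fix r' assume "\<exists>P\<in>Rpoly n. P \<noteq> 0 \<and> (\<forall>a. peval a P \<noteq> 0 \<longrightarrow> redn n I (linform n a) = r')"
  then obtain Q where Q: "Q \<noteq> 0" "\<And>a. peval a Q \<noteq> 0 \<Longrightarrow> redn n I (linform n a) = r'" by blast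
  have "P * Q \<noteq> 0" using P(2) Q(1) by simp
  then obtain a where "peval a (P * Q) \<noteq> 0" using exists_nonroot by blast
  then have "peval a P \<noteq> 0" "peval a Q \<noteq> 0" by (auto simp: peval_mult)
  then show "r' = r" using P(3) Q(2) by metis
qed (use P in blast)

context graded_quotient
begin

lemma pi_linform: "\<pi> (linform n a * f) = (\<Sum>i<n. const (a i) * \<pi> (var i * f))"
  by (simp add: linform_def sum_distrib_right pi.sum mult.assoc pi.scale)

text \<open>Choose preimages \<open>f j\<close> of a basis under the form at \<open>a0\<close>. The
  coordinates of their products with a general form are linear in its coefficients, and the
  determinant of the matrix they form is \<open>P\<close>.\<close>

lemma generic_rank:
  assumes a0: "rank (linform n a0) d = hilb n I (Suc d)"
  obtains P where "P \<in> Rpoly n" "P \<noteq> 0"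
    "\<And>a. peval a P \<noteq> 0 \<Longrightarrow> rank (linform n a) d = hilb n I (Suc d)"
proof -
  obtain B where B: "B \<subseteq> V (Suc d)" "mp.independent B" "V (Suc d) \<subseteq> mp.span B" "finite B"
    using mp.fin_dim_basis[OF fin_dim_V] by metis
  define N where "N = card B"
  obtain b where b: "bij_betw b {0..<N} B"
    using ex_bij_betw_nat_finite[OF B(4)] N_def by blast
  have bB: "b k \<in> B" if "k < N" for k using b that by (auto simp: bij_betw_def)
  have "\<forall>j\<in>{..<N}. \<exists>f. f \<in> Rdeg n d \<and> \<pi> (linform n a0 * f) = b j"
  proof
    fix j assume "j \<in> {..<N}"
    then have "b j \<in> V (Suc d)" using bB B(1) by auto
    then obtain g where g: "g \<in> Rdeg n (Suc d)" "b j = \<pi> g" by (auto simp: V_def)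
    then obtain f where "f \<in> Rdeg n d" "g - linform n a0 * f \<in> I"
      using a0 rank_surj[OF linform_Rdeg] by blast
    then show "\<exists>f. f \<in> Rdeg n d \<and> \<pi> (linform n a0 * f) = b j"
      using g(2) pi_eq_iff by metis
  qed
  then obtain f where "\<forall>j\<in>{..<N}. f j \<in> Rdeg n d \<and> \<pi> (linform n a0 * f j) = b j"
    by (rule bchoice[THEN exE])
  then have f: "f j \<in> Rdeg n d" "\<pi> (linform n a0 * f j) = b j" if "j < N" for j using that by auto
  define c where "c i j k = mp.representation B (\<pi> (var i * f j)) (b k)" for i j k
  have inV: "\<pi> (var i * f j) \<in> mp.span B" if "i < n" "j < N" for i j
  proof -
    have "var i * f j \<in> Rdeg n (Suc d)" using Rdeg_mult[OF Rdeg_var f(1)] that by simp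
    then show ?thesis using B(3) by (auto simp: V_def)
  qed
  have rep: "mp.representation B (\<pi> (linform n a * f j)) (b k) = (\<Sum>i<n. a i * c i j k)"
    if "j < N" for a j k
  proof -
    have "mp.representation B (\<pi> (linform n a * f j))
        = (\<lambda>v. \<Sum>i<n. mp.representation B (const (a i) * \<pi> (var i * f j)) v)"
      unfolding pi_linform
      by (rule mp.representation_sum[OF B(2)]) (use inV that in \<open>auto intro: mp.span_scale\<close>)
    then show ?thesis
      using mp.representation_scale[OF B(2) inV] that by (simp add: c_def)
  qed
  have expand: "\<pi> (linform n a * f j) = (\<Sum>k<N. const (\<Sum>i<n. a i * c i j k) * b k)"
    if "j < N" for a j
  proof -
    have "\<pi> (linform n a * f j) \<in> mp.span B"
      unfolding pi_linform using inV that by (intro mp.span_sum mp.span_scale) auto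
    then have "\<pi> (linform n a * f j)
        = (\<Sum>v\<in>B. const (mp.representation B (\<pi> (linform n a * f j)) v) * v)"
      using mp.sum_representation_eq[OF B(2) _ B(4)] by simp
    also have "\<dots> = (\<Sum>k\<in>{0..<N}. const (mp.representation B (\<pi> (linform n a * f j)) (b k)) * b k)"
      by (rule sum.reindex_bij_betw[OF b, symmetric])
    finally show ?thesis using rep[OF that] by (simp add: atLeast0LessThan)
  qed
  \<comment> \<open>Column \<open>j\<close> holds the coordinates of the product with
    \<open>f j\<close>; in \<open>PM\<close> the coefficients of the form are variables, in
    \<open>M a\<close> they are the values \<open>a i\<close>.\<close>
  define PM where "PM = mat N N (\<lambda>(k, j). \<Sum>i<n. const (c i j k) * var i)"
  define M where "M a = mat N N (\<lambda>(k, j). \<Sum>i<n. a i * c i j k)" for a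
  have PM: "PM \<in> carrier_mat N N" and M: "M a \<in> carrier_mat N N" for a
    by (simp_all add: PM_def M_def)
  have peval_det: "peval a (det PM) = det (M a)" for a
  proof -
    interpret h: comm_ring_hom "peval a" by (rule peval_hom)
    have "map_mat (peval a) PM = M a"
      by (rule eq_matI) (auto simp: PM_def M_def peval_sum peval_mult peval_const peval_var mult.commute)
    then show ?thesis using h.hom_det[of PM] by simp
  qed
  have "det PM \<in> Rpoly n"
    unfolding det_def'[OF PM]
  proof (intro Rpoly_sum Rpoly_mult)
    fix p assume p: "p \<in> {p. p permutes {0..<N}}"
    show "signof p \<in> Rpoly n"
      using Rpoly_const[of 1 n] Rpoly_uminus[OF Rpoly_const[of 1 n]] by (auto simp: const_simps sign_def)
    have "PM $$ (i, p i) \<in> Rpoly n" if "i \<in> {0..<N}" for i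
    proof -
      have "p i < N" using p that permutes_in_image[of p "{0..<N}" i] by auto
      then show ?thesis using that
        by (auto simp: PM_def intro!: Rpoly_sum Rpoly_mult Rpoly_const Rpoly_var)
    qed
    then show "(\<Prod>i = 0..<N. PM $$ (i, p i)) \<in> Rpoly n" by (rule Rpoly_prod)
  qed
  moreover have "det PM \<noteq> 0"
  proof -
    \<comment> \<open>At \<open>a0\<close> the products are the basis vectors themselves.\<close>
    have "M a0 = 1\<^sub>m N"
    proof (rule eq_matI)
      fix k j assume kj: "k < dim_row (1\<^sub>m N)" "j < dim_col (1\<^sub>m N)"
      then have "M a0 $$ (k, j) = mp.representation B (b j) (b k)"
        using rep[of j a0 k] f(2)[of j] by (simp add: M_def)
      also have "\<dots> = (if b k = b j then 1 else 0)"
        using mp.representation_basis[OF B(2) bB[of j]] kj by simp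
      also have "\<dots> = 1\<^sub>m N $$ (k, j)"
        using kj b by (auto simp: bij_betw_def inj_on_eq_iff)
      finally show "M a0 $$ (k, j) = 1\<^sub>m N $$ (k, j)" .
    qed (simp_all add: M_def)
    then have "peval a0 (det PM) = 1" using peval_det[of a0] by simp
    then show ?thesis by (auto simp: peval_zero)
  qed
  moreover have "rank (linform n a) d = hilb n I (Suc d)" if nz: "peval a (det PM) \<noteq> 0" for a
  proof -
    interpret mul: Vector_Spaces.linear "\<lambda>c p. const c * p" "\<lambda>c p. const c * p" "mul (linform n a)"
      by (fact linear_mul)
    have LR: "linform n a \<in> Rpoly n" using linform_Rdeg Rdeg_subset_Rpoly by blast
    let ?W = "mul (linform n a) ` V d"
    have W: "mp.subspace ?W" by (rule mul.subspace_image[OF subspace_V])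
    have u: "\<pi> (linform n a * f j) \<in> ?W" if "j < N" for j
      using f(1)[OF that] mul_pi[OF LR, of "f j"] unfolding V_def by (metis imageI)
    \<comment> \<open>Cramer's rule: the columns of the adjugate combine the products into
      \<open>det (M a)\<close> times the basis vectors, so a nonzero determinant puts the basis into
      the image.\<close>
    let ?A = "adj_mat (M a)"
    have A: "?A \<in> carrier_mat N N" "M a * ?A = det (M a) \<cdot>\<^sub>m 1\<^sub>m N" using adj_mat[OF M] by auto
    have "b l \<in> ?W" if l: "l < N" for l
    proof -
      have ent: "(\<Sum>j<N. M a $$ (k, j) * ?A $$ (j, l)) = (if k = l then det (M a) else 0)" if "k < N" for k
      proof -
        have "(M a * ?A) $$ (k, l) = (\<Sum>j<N. M a $$ (k, j) * ?A $$ (j, l))"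
          using that l A(1) M[of a] by (simp add: scalar_prod_def atLeast0LessThan)
        then show ?thesis using A(2) that l by (auto split: if_splits)
      qed
      have "(\<Sum>j<N. const (?A $$ (j, l)) * \<pi> (linform n a * f j))
          = (\<Sum>j<N. \<Sum>k<N. const (M a $$ (k, j) * ?A $$ (j, l)) * b k)"
      proof (rule sum.cong)
        fix j assume "j \<in> {..<N}"
        then have "\<pi> (linform n a * f j) = (\<Sum>k<N. const (M a $$ (k, j)) * b k)"
          by (simp add: expand M_def)
        then show "const (?A $$ (j, l)) * \<pi> (linform n a * f j)
            = (\<Sum>k<N. const (M a $$ (k, j) * ?A $$ (j, l)) * b k)"
          by (simp add: sum_distrib_left const_simps(4) mult_ac)
      qed simp
      also have "\<dots> = (\<Sum>k<N. const (\<Sum>j<N. M a $$ (k, j) * ?A $$ (j, l)) * b k)"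
        by (subst sum.swap) (simp add: mp.scale_sum_left)
      also have "\<dots> = (\<Sum>k<N. if k = l then const (det (M a)) * b k else 0)"
        by (intro sum.cong) (auto simp: ent const_simps)
      also have "\<dots> = const (det (M a)) * b l" using l by (simp add: sum.delta)
      finally have eq: "(\<Sum>j<N. const (?A $$ (j, l)) * \<pi> (linform n a * f j)) = const (det (M a)) * b l" .
      have "(\<Sum>j<N. const (?A $$ (j, l)) * \<pi> (linform n a * f j)) \<in> ?W"
        using u by (intro mp.subspace_sum[OF W] mp.subspace_scale[OF W]) auto
      then have "const (inverse (det (M a))) * (const (det (M a)) * b l) \<in> ?W"
        unfolding eq by (rule mp.subspace_scale[OF W])
      then show "b l \<in> ?W"
        using nz peval_det[of a] by (simp add: mult.assoc[symmetric] const_simps(4)[symmetric] const_simps(2))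
    qed
    then have "B \<subseteq> ?W" using b by (auto simp: bij_betw_def)
    then have "V (Suc d) \<subseteq> ?W" using B(3) mp.span_minimal[OF _ W] by blast
    then have "?W = V (Suc d)" using mul_V[OF linform_Rdeg, of a d] by blast
    then show ?thesis by (simp add: rank_def hilb_eq_dim)
  qed
  ultimately show thesis by (rule that)
qed

end

section \<open>Lefschetz elements\<close>

text \<open>The ideal I + (L), whose quotient is A/LA.\<close>

definition add_form :: "nat \<Rightarrow> 'k::field mpoly set \<Rightarrow> 'k mpoly \<Rightarrow> 'k mpoly set" where
  "add_form n I L = {p + L * f | p f. p \<in> I \<and> f \<in> Rpoly n}"

context graded_quotient
begin

lemma hcomp_0_mult:
  assumes L: "L \<in> Rdeg n 1" and f: "f \<in> Rpoly n"
  shows "hcomp 0 (L * f) = 0"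
proof -
  have "L * f = (\<Sum>d\<in>mdeg ` Poly_Mapping.keys f. L * hcomp d f)"
    using hcomp_decomp[of f] by (metis sum_distrib_left)
  moreover have "hcomp 0 (L * hcomp d f) = 0" for d
    using hcomp_of_Rdeg[OF Rdeg_mult[OF L hcomp_Rdeg[OF f, of d]], of 0] by simp
  ultimately show ?thesis by (simp add: hcomp_sum)
qed

lemma hom_ideal_add_form:
  assumes L: "L \<in> Rdeg n 1"
  shows "hom_ideal n (add_form n I L)"
proof -
  have LR: "L \<in> Rpoly n" using L Rdeg_subset_Rpoly by blast
  have J: "p + L * f \<in> add_form n I L" if "p \<in> I" "f \<in> Rpoly n" for p f
    using that by (auto simp: add_form_def)
  show ?thesis
    unfolding hom_ideal_def
  proof (intro conjI ballI allI)
    show "add_form n I L \<subseteq> Rpoly n"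
      by (auto simp: add_form_def intro: Rpoly_add[OF ideal_Rpoly Rpoly_mult[OF LR]])
    show "0 \<in> add_form n I L" using J[OF ideal_zero Rpoly_zero] by simp
  next
    fix x y assume "x \<in> add_form n I L" "y \<in> add_form n I L"
    then obtain p f q g where "p \<in> I" "f \<in> Rpoly n" "x = p + L * f" "q \<in> I" "g \<in> Rpoly n" "y = q + L * g"
      by (auto simp: add_form_def)
    then show "x + y \<in> add_form n I L"
      using J[OF ideal_add[of p q] Rpoly_add[of f n g]] by (simp add: algebra_simps)
  next
    fix r x :: "'k mpoly" assume r: "r \<in> Rpoly n" and "x \<in> add_form n I L"
    then obtain p f where "p \<in> I" "f \<in> Rpoly n" "x = p + L * f" by (auto simp: add_form_def)
    then show "r * x \<in> add_form n I L"
      using J[OF ideal_mult[OF r, of p] Rpoly_mult[OF r, of f]] by (simp add: algebra_simps)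
  next
    fix x d assume "x \<in> add_form n I L"
    then obtain p f where pf: "p \<in> I" "f \<in> Rpoly n" "x = p + L * f" by (auto simp: add_form_def)
    show "hcomp d x \<in> add_form n I L"
    proof (cases d)
      case 0
      then have "hcomp d x = hcomp d p + L * 0"
        using pf hcomp_0_mult[OF L pf(2)] by (simp add: hcomp_add)
      then show ?thesis using J[OF ideal_hcomp[OF pf(1)] Rpoly_zero] by metis
    next
      case (Suc e)
      then have "hcomp d x = hcomp d p + L * hcomp e f"
        using pf hcomp_mult[OF L pf(2), of e] by (simp add: hcomp_add)
      moreover have "hcomp e f \<in> Rpoly n" using hcomp_Rdeg[OF pf(2)] Rdeg_subset_Rpoly by blast
      ultimately show ?thesis using J[OF ideal_hcomp[OF pf(1)]] by metis
    qed
  qed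
qed

text \<open>The kernel of the map from A_(d+1) to (A/LA)_(d+1) is L A_d; apply rank-nullity.\<close>

lemma hilb_add_form:
  assumes L: "L \<in> Rdeg n 1"
  shows "hilb n (add_form n I L) (Suc d) + rank L d = hilb n I (Suc d)"
proof -
  have LR: "L \<in> Rpoly n" using L Rdeg_subset_Rpoly by blast
  obtain \<rho> where "graded_quotient n (add_form n I L) \<rho>"
    using exists_graded_quotient[OF hom_ideal_add_form[OF L]] by blast
  then interpret J: graded_quotient n "add_form n I L" \<rho> .
  have IJ: "p \<in> add_form n I L" if "p \<in> I" for p
    unfolding add_form_def using that Rpoly_zero[of n] by (intro CollectI exI[of _ p] exI[of _ 0]) simp
  have LJ: "L * f \<in> add_form n I L" if "f \<in> Rpoly n" for f
    unfolding add_form_def using that ideal_zero by (intro CollectI exI[of _ 0] exI[of _ f]) simp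
  have rho_pi: "\<rho> (\<pi> f) = \<rho> f" for f
    using IJ[OF ideal_uminus[OF pi_diff[of f]]] by (simp add: J.pi_eq_iff)
  have img: "\<rho> ` V (Suc d) = J.V (Suc d)"
    by (simp add: V_def J.V_def image_image rho_pi)
  have ker: "{v \<in> V (Suc d). \<rho> v = 0} = mul L ` V d"
  proof (intro equalityI subsetI)
    fix v assume "v \<in> {v \<in> V (Suc d). \<rho> v = 0}"
    then obtain g where g: "g \<in> Rdeg n (Suc d)" "v = \<pi> g" "g \<in> add_form n I L"
      unfolding V_def using rho_pi J.pi_eq_0 by (smt (verit) imageE mem_Collect_eq)
    then obtain p f where pf: "p \<in> I" "f \<in> Rpoly n" "g = p + L * f" by (auto simp: add_form_def)
    \<comment> \<open>Comparing components of degree d + 1 makes the multiplier \<open>f\<close>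
      homogeneous of degree \<open>d\<close>.\<close>
    have "g = hcomp (Suc d) g" using hcomp_of_Rdeg[OF g(1)] by simp
    also have "\<dots> = hcomp (Suc d) p + L * hcomp d f"
      using pf hcomp_mult[OF L pf(2), of d] by (simp add: hcomp_add)
    finally have "g - L * hcomp d f \<in> I" using ideal_hcomp[OF pf(1), of "Suc d"] by simp
    then have "v = mul L (\<pi> (hcomp d f))" using g(2) by (simp add: mul_pi[OF LR] pi_eq_iff)
    then show "v \<in> mul L ` V d" using hcomp_Rdeg[OF pf(2), of d] by (auto simp: V_def)
  next
    fix v assume v: "v \<in> mul L ` V d"
    then obtain f where f: "f \<in> Rdeg n d" "v = \<pi> (L * f)" by (auto simp: V_def mul_pi[OF LR])
    have "\<rho> v = 0"
      using f LJ[of f] Rdeg_subset_Rpoly[of n d] by (auto simp: rho_pi J.pi_eq_0)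
    then show "v \<in> {v \<in> V (Suc d). \<rho> v = 0}" using v mul_V[OF L, of d] by blast
  qed
  show ?thesis
    using mp.rank_nullity(1)[OF J.linear_pi subspace_V fin_dim_V, of "Suc d"]
    by (simp add: hilb_eq_dim J.hilb_eq_dim rank_def ker img)
qed

text \<open>Each difference is the dimension of the kernel of multiplication by the form, so the
  natural subtraction is exact.\<close>

lemma kernel_bound:
  assumes j: "j < n" "a j \<noteq> 0"
    and socle: "\<And>f. f \<in> Rdeg n d \<Longrightarrow> \<forall>i<n. var i * f \<in> I \<Longrightarrow> f \<in> I"
  shows "hilb n I d - rank (linform n a) d
    \<le> (n - 1) * (hilb n I (Suc d) - rank (linform n a) (Suc d))"
proof -
  let ?L = "linform n a"
  define K where "K d = {v \<in> V d. mul ?L v = 0}" for d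
  have LR: "?L \<in> Rpoly n" using linform_Rdeg Rdeg_subset_Rpoly by blast
  interpret mul: Vector_Spaces.linear "\<lambda>c p. const c * p" "\<lambda>c p. const c * p" "mul ?L"
    by (fact linear_mul)
  have sub: "mp.subspace (K d)" for d
    using subspace_V[of d] mul.zero mul.add mul.scale
    unfolding K_def mp.subspace_def by auto
  have fin: "mp.fin_dim (K d)" for d
    by (rule mp.fin_dim_subset[OF fin_dim_V]) (auto simp: K_def)
  have dimK: "mp.dim (K d) = hilb n I d - rank ?L d" for d
    using kernel_dim[of d ?L] by (simp add: K_def)
  have "mp.dim (K d) \<le> card ({..<n} - {j}) * mp.dim (K (Suc d))"
  proof (rule mp.joint_kernel_dim[where g = "\<lambda>i. mul (var i)"])
    show "mul (var i) ` K d \<subseteq> K (Suc d)" if "i \<in> {..<n} - {j}" for i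
    proof (rule image_subsetI)
      fix v assume v: "v \<in> K d"
      have i: "i < n" using that by simp
      have "mul ?L (mul (var i) v) = \<pi> (?L * (var i * v))"
        by (simp add: mul_def pi_mult[OF LR])
      also have "\<dots> = \<pi> (var i * (?L * v))" by (simp add: mult_ac)
      also have "\<dots> = mul (var i) (mul ?L v)"
        by (simp add: mul_def pi_mult[OF Rpoly_var[OF i]])
      also have "\<dots> = 0" using v by (simp add: K_def) (simp add: mul_def pi_eq_0 ideal_zero)
      finally show "mul (var i) v \<in> K (Suc d)"
        using v mul_V[OF Rdeg_var[OF i], of d] by (auto simp: K_def)
    qed
    fix v assume v: "v \<in> K d" and all: "\<forall>i\<in>{..<n} - {j}. mul (var i) v = 0"
    obtain f where f: "f \<in> Rdeg n d" "v = \<pi> f" using v by (auto simp: K_def V_def)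
    have xi: "var i * f \<in> I" if "i < n" "i \<noteq> j" for i
    proof -
      have "mul (var i) v = 0" using all that by simp
      then show ?thesis using that f(2) by (simp add: mul_pi Rpoly_var pi_eq_0)
    qed
    \<comment> \<open>Since x_i f lies in \<open>I\<close> for all i other than \<open>j\<close>,
      the vanishing of L f in A leaves only a_j x_j f, and a_j is invertible.\<close>
    have "0 = (\<Sum>i<n. const (a i) * \<pi> (var i * f))"
      using v f(2) mul_pi[OF LR, of f] by (simp add: K_def pi_linform)
    also have "\<dots> = (\<Sum>i<n. if i = j then const (a j) * \<pi> (var j * f) else 0)"
    proof (rule sum.cong)
      fix i assume "i \<in> {..<n}"
      then show "const (a i) * \<pi> (var i * f) = (if i = j then const (a j) * \<pi> (var j * f) else 0)"
        using xi[of i] pi_eq_0[of "var i * f"] by auto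
    qed simp
    also have "\<dots> = const (a j) * \<pi> (var j * f)" using j(1) by simp
    finally have "\<pi> (var j * f) = 0" using j(2) mp.scale_eq_0_iff[of "a j"] by metis
    then have "\<forall>i<n. var i * f \<in> I" using xi by (metis pi_eq_0)
    then show "v = 0" using socle f by (simp add: pi_eq_0)
  qed (use linear_mul sub fin in auto)
  moreover have "card ({..<n} - {j}) = n - 1" using j(1) by simp
  ultimately show ?thesis by (simp add: dimK)
qed

lemma hilb_0_le: "hilb n I 0 \<le> 1"
proof -
  define B where "B = {m \<in> monoms n 0. \<pi> (Poly_Mapping.single m 1) \<notin>
    mp.span ((\<lambda>m. \<pi> (Poly_Mapping.single m 1)) ` {m' \<in> monoms n 0. m' < m})}"
  have "card B \<le> card (monoms n 0)" by (rule card_mono[OF finite_monoms]) (auto simp: B_def)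
  then show ?thesis using monomial_basis(1)[of 0] by (simp add: B_def monoms_0)
qed

lemma hilb_eq_0_Suc:
  assumes "hilb n I d = 0"
  shows "hilb n I (Suc d) = 0"
  unfolding hilb_eq_0_iff
proof
  have d: "Rdeg n d \<subseteq> I" using assms by (simp add: hilb_eq_0_iff)
  fix g :: "'k mpoly" assume "g \<in> Rdeg n (Suc d)"
  then obtain f where f: "\<And>i. i < n \<Longrightarrow> f i \<in> Rdeg n d" "g = (\<Sum>i<n. var i * f i)"
    using Rdeg_Suc_decomp by blast
  show "g \<in> I" unfolding f(2) using f(1) d by (intro ideal_sum ideal_mult Rpoly_var) auto
qed

lemma hilb_eq_0_mono: "hilb n I d = 0 \<Longrightarrow> d \<le> e \<Longrightarrow> hilb n I e = 0"
  by (rotate_tac 1, induction e rule: dec_induct) (auto simp: hilb_eq_0_Suc)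

text \<open>The degree \<open>t\<close> in \<open>level\<close> must be \<open>s\<close>: every
  element of A_s lies in the socle, as A vanishes in degree s + 1, and some such element is
  nonzero.\<close>

lemma socle_in_ideal:
  assumes lev: "level n I" and s: "hilb n I s \<noteq> 0" "hilb n I (Suc s) = 0"
    and d: "d \<noteq> s" and f: "f \<in> Rdeg n d" "\<forall>i<n. var i * f \<in> I"
  shows "f \<in> I"
proof -
  obtain t where t: "\<And>p. p \<in> Rpoly n \<Longrightarrow> \<forall>i<n. var i * p \<in> I \<Longrightarrow> p - hcomp t p \<in> I"
    using lev by (auto simp: level_def)
  obtain p where p: "p \<in> Rdeg n s" "p \<notin> I" using s(1) by (auto simp: hilb_eq_0_iff)
  have "\<forall>i<n. var i * p \<in> I"
  proof (intro allI impI)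
    fix i assume "i < n"
    then have "var i * p \<in> Rdeg n (Suc s)" using Rdeg_mult[OF Rdeg_var p(1)] by simp
    then show "var i * p \<in> I" using s(2) by (auto simp: hilb_eq_0_iff)
  qed
  then have "p - hcomp t p \<in> I" using t p(1) Rdeg_subset_Rpoly by blast
  then have "t = s" using p hcomp_of_Rdeg[OF p(1), of t] by (auto split: if_splits)
  then show ?thesis
    using t[of f] f d Rdeg_subset_Rpoly[of n d] hcomp_of_Rdeg[OF f(1), of t] by auto
qed

end

text \<open>Take a linear form of least reduction number. By \<open>generic_rank\<close> its
  surjectivity persists on an open set, so the generic reduction number is no larger, hence equal to
  this minimum.\<close>

lemma r1_minimal:
  fixes I :: "'k::field_char_0 mpoly set"
  assumes gq: "graded_quotient n I \<pi>" and s: "hilb n I (Suc s) = 0"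
  obtains L where "L \<in> Rdeg n 1" "redn n I L = r1 n I"
    "\<And>L'. L' \<in> Rdeg n 1 \<Longrightarrow> r1 n I \<le> redn n I L'"
proof -
  interpret graded_quotient n I \<pi> by (fact gq)
  have ex: "\<exists>d. rank L d = hilb n I (Suc d)" if "L \<in> Rdeg n 1" for L
    using rank_le(2)[OF that, of s] s by (intro exI[of _ s]) simp
  obtain a0 where min: "\<And>a. redn n I (linform n a0) \<le> redn n I (linform n a)"
    using ex_has_least_nat[of "\<lambda>_. True" _ "\<lambda>a. redn n I (linform n a)"] by blast
  let ?r = "redn n I (linform n a0)"
  have "rank (linform n a0) ?r = hilb n I (Suc ?r)"
    using redn_le_iff[OF linform_Rdeg ex[OF linform_Rdeg], of a0 ?r] by simp
  then obtain P where P: "P \<in> Rpoly n" "P \<noteq> 0"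
    "\<And>a. peval a P \<noteq> 0 \<Longrightarrow> rank (linform n a) ?r = hilb n I (Suc ?r)"
    using generic_rank by metis
  have r1: "r1 n I = ?r"
  proof (rule r1_eqI[OF P(1,2)])
    fix a assume "peval a P \<noteq> 0"
    then have "redn n I (linform n a) \<le> ?r"
      using redn_le_iff[OF linform_Rdeg ex[OF linform_Rdeg], of a ?r] P(3) by blast
    then show "redn n I (linform n a) = ?r" using min[of a] by simp
  qed
  show thesis
  proof (rule that[OF linform_Rdeg])
    show "redn n I (linform n a0) = r1 n I" using r1 by simp
    show "r1 n I \<le> redn n I L'" if L': "L' \<in> Rdeg n 1" for L'
    proof -
      obtain a where "L' = linform n a" using Rdeg_1_linform[OF L'] by blast
      then show ?thesis using min[of a] r1 by simp
    qed
  qed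
qed

lemma O_seqI:
  assumes "h 0 = 1" "\<And>i. i \<ge> 1 \<Longrightarrow> h (Suc i) \<le> mac_up i (h i)"
  shows "O_seq h"
  using assms by (simp add: O_seq_def mac_pow_eq_mac_up)

text \<open>Natural subtraction in the second \<open>O_seq\<close> yields the positive part of the
  first difference, whereas the differences in (b) are integers.\<close>

theorem theorem3p6:
  fixes n s :: nat and I :: "'k::field_char_0 mpoly set"
  defines "h \<equiv> hilb n I"
  defines "\<theta> \<equiv> (LEAST t. h t > h (Suc t))"
  defines "r \<equiv> r1 n I"
  assumes n3: "n \<ge> 3"
    and ideal: "hom_ideal n I"
    and socdeg: "h s \<noteq> 0" "h (Suc s) = 0"
    and lev: "level n I"
    and wlp: "WLP n I s"
  shows "O_seq h
      \<and> (\<forall>i<r. h i < h (Suc i))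
      \<and> r \<le> \<theta>
      \<and> (\<forall>i. r \<le> i \<and> i < \<theta> \<longrightarrow> h i = h (Suc i))
      \<and> (\<forall>i. \<theta> \<le> i \<and> i < s \<longrightarrow> h i > h (Suc i))
      \<and> O_seq (\<lambda>i. if i = 0 then h 0 else h i - h (i - 1))
      \<and> (\<forall>d. \<theta> < d \<and> d \<le> s \<longrightarrow>
            int (h (d - 1)) - int (h d) \<le> (int n - 1) * (int (h d) - int (h (Suc d))))"
proof -
  obtain \<pi> where gq: "graded_quotient n I \<pi>" using exists_graded_quotient[OF ideal] by blast
  then interpret graded_quotient n I \<pi> .
  have h_zero: "h e = 0" if "s < e" for e
    using hilb_eq_0_mono[of "Suc s" e] socdeg(2) that by (simp add: h_def)
  have h_nz: "h e \<noteq> 0" if "e \<le> s" for e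
    using hilb_eq_0_mono[of e s] socdeg(1) that by (auto simp: h_def)
  have h0: "h 0 = 1" using hilb_0_le h_nz[of 0] by (simp add: h_def)
  \<comment> \<open>\<open>WLP\<close> starts in degree 1 and is vacuous for
    \<open>s \<le> 1\<close>, so for s = 1 its witness may be zero in A and is replaced by a nonzero
    element of A_1.\<close>
  obtain L where L: "L \<in> Rdeg n 1" and LI: "s \<ge> 1 \<Longrightarrow> L \<notin> I"
    and maxrank: "\<And>i. 1 \<le> i \<Longrightarrow> i < s \<Longrightarrow> rank L i = h i \<or> rank L i = h (Suc i)"
  proof -
    obtain L0 where L0: "L0 \<in> Rdeg n 1" and w: "\<And>i. 1 \<le> i \<Longrightarrow> i \<le> s - 1 \<Longrightarrow>
        (\<forall>f\<in>Rdeg n i. L0 * f \<in> I \<longrightarrow> f \<in> I) \<or> (\<forall>g\<in>Rdeg n (Suc i). \<exists>f\<in>Rdeg n i. g - L0 * f \<in> I)"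
      using wlp by (auto simp: WLP_def)
    have mr: "rank L0 i = h i \<or> rank L0 i = h (Suc i)" if "1 \<le> i" "i < s" for i
      using w[of i] that unfolding h_def rank_inj[OF L0] rank_surj[OF L0] by simp
    show thesis
    proof (cases "s \<le> 1")
      case True
      show thesis
      proof (cases "s = 1")
        case True
        then obtain L1 where "L1 \<in> Rdeg n 1" "L1 \<notin> I"
          using h_nz[of 1] by (auto simp: h_def hilb_eq_0_iff)
        then show thesis using True by (intro that[of L1]) auto
      qed (use \<open>s \<le> 1\<close> L0 in \<open>auto intro: that[of L0]\<close>)
    next
      case False
      \<comment> \<open>Otherwise the rank in degree 1 would be 0, while \<open>h 1\<close> and
        \<open>h 2\<close> are nonzero for s at least 2.\<close>
      have "L0 \<notin> I"
      proof
        assume "L0 \<in> I"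
        then have "mul L0 ` V 1 \<subseteq> {0}"
          using ideal_mult[of _ L0] Rdeg_subset_Rpoly[of n 1]
          by (auto simp: V_def mul_pi[OF subsetD[OF Rdeg_subset_Rpoly L0]] pi_eq_0 mult.commute[of L0])
        then have "rank L0 1 = 0"
          unfolding rank_def using mp.dim_zero_iff[OF mp.fin_dim_subset[OF fin_dim_V mul_V[OF L0]]] by blast
        then show False using mr[of 1] h_nz[of 1] h_nz[of 2] False by (auto simp: numeral_2_eq_2)
      qed
      then show thesis using L0 mr by (intro that[of L0]) auto
    qed
  qed
  have LR: "L \<in> Rpoly n" using L Rdeg_subset_Rpoly by blast
  \<comment> \<open>Degree 0 lies outside \<open>WLP\<close>; for s at least 1 the rank there is 1
    because \<open>L\<close> is nonzero in A. From degree \<open>s\<close> on the target is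
    zero.\<close>
  have full_rank: "rank L i = h i \<or> rank L i = h (Suc i)" for i
  proof -
    consider "i \<ge> s" | "i = 0" "s \<ge> 1" | "1 \<le> i" "i < s" by linarith
    then show ?thesis
    proof cases
      case 1
      then show ?thesis using h_zero[of "Suc i"] rank_le(2)[OF L, of i] by (simp add: h_def)
    next
      case 2
      have "rank L 0 \<noteq> 0"
      proof
        assume "rank L 0 = 0"
        then have "mul L ` V 0 \<subseteq> {0}"
          unfolding rank_def using mp.dim_zero_iff[OF mp.fin_dim_subset[OF fin_dim_V mul_V[OF L]]] by blast
        moreover have "\<pi> 1 \<in> V 0"
          unfolding V_def by (rule imageI) (simp add: Rdeg_iff monoms_0)
        ultimately have "mul L (\<pi> 1) = 0" by blast
        then have "L \<in> I" by (simp add: mul_pi[OF LR] pi_eq_0)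
        then show False using LI[OF 2(2)] by simp
      qed
      then show ?thesis using rank_le(1)[OF L, of 0] h0 2 by (simp add: h_def)
    next
      case 3
      then show ?thesis by (rule maxrank)
    qed
  qed
  have surj_iff: "redn n I L' \<le> d \<longleftrightarrow> rank L' d = h (Suc d)" if "L' \<in> Rdeg n 1" for L' d
    unfolding h_def
  proof (rule redn_le_iff[OF that], rule exI)
    show "rank L' s = hilb n I (Suc s)"
      using rank_le(2)[OF that, of s] socdeg(2) by (simp add: h_def)
  qed
  obtain L1 where L1: "L1 \<in> Rdeg n 1" "redn n I L1 = r" and r_le: "r \<le> redn n I L"
    using r1_minimal[OF gq, of s] socdeg(2) L unfolding r_def h_def by metis
  \<comment> \<open>Below \<open>r\<close>, multiplication by \<open>L\<close> is not surjective, so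
    maximal rank makes it injective with a proper image.\<close>
  have inc: "h i < h (Suc i)" if "i < r" for i
    using surj_iff[OF L, of i] that r_le full_rank[of i] rank_le(2)[OF L, of i] by (auto simp: h_def)
  have dec: "h (Suc i) \<le> h i" if "r \<le> i" for i
    using surj_iff[OF L1(1), of i] that L1(2) rank_le(1)[OF L1(1), of i] by (simp add: h_def)
  have "h s > h (Suc s)" using socdeg by simp
  then have theta: "h \<theta> > h (Suc \<theta>)" unfolding \<theta>_def by (rule LeastI)
  have before: "h i \<le> h (Suc i)" if "i < \<theta>" for i
    using not_less_Least[of i "\<lambda>t. h t > h (Suc t)"] that by (simp add: \<theta>_def)
  have r_theta: "r \<le> \<theta>" using inc[of \<theta>] theta by force
  \<comment> \<open>At \<open>\<theta>\<close> the target is smaller than the source, so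
    \<open>L\<close> is not injective. It is then surjective there, and hence in all later
    degrees.\<close>
  have "rank L \<theta> = h (Suc \<theta>)"
    using full_rank[of \<theta>] rank_le(2)[OF L, of \<theta>] theta by (auto simp: h_def)
  then have surj: "rank L i = h (Suc i)" if "\<theta> \<le> i" for i
    using surj_iff[OF L, of \<theta>] surj_iff[OF L, of i] that by simp
  have drop: "h (Suc i) \<le> h i" if "\<theta> \<le> i" for i
    using dec r_theta that by simp
  have b: "int (h (d - 1)) - int (h d) \<le> (int n - 1) * (int (h d) - int (h (Suc d)))"
    if d: "\<theta> < d" "d \<le> s" for d
  proof -
    obtain e where e: "d = Suc e" using d by (cases d) auto
    obtain a where a: "L = linform n a" using Rdeg_1_linform[OF L] by blast
    have "\<exists>j<n. a j \<noteq> 0"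
    proof (rule ccontr)
      assume "\<not> (\<exists>j<n. a j \<noteq> 0)"
      then have "L = 0" unfolding a linform_def by (simp add: const_simps)
      then show False using LI d ideal_zero by simp
    qed
    then obtain j where j: "j < n" "a j \<noteq> 0" by blast
    \<comment> \<open>The socle condition holds in degree \<open>e\<close> because e < s.\<close>
    have "hilb n I e - rank L e \<le> (n - 1) * (hilb n I (Suc e) - rank L (Suc e))"
      unfolding a by (rule kernel_bound[where a = a, OF j])
        (use socle_in_ideal[OF lev, of s e] socdeg d e in \<open>auto simp: h_def\<close>)
    then have "h e - h d \<le> (n - 1) * (h d - h (Suc d))"
      using surj[of e] surj[of d] d e by (simp add: h_def)
    then have "int (h e - h d) \<le> int ((n - 1) * (h d - h (Suc d)))" by (rule of_nat_mono)
    then show ?thesis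
      using drop[of e] drop[of d] d e n3 by (simp add: of_nat_diff)
  qed
  \<comment> \<open>Starting from the drop at \<open>\<theta>\<close>, (b) at i + 1 has a positive
    left side and so forces the next drop to be positive.\<close>
  have strict: "h i > h (Suc i)" if "\<theta> \<le> i" "i < s" for i
    using that
  proof (induction i rule: dec_induct)
    case (step i)
    then have "0 < int (h i) - int (h (Suc i))" by simp
    also have "\<dots> \<le> (int n - 1) * (int (h (Suc i)) - int (h (Suc (Suc i))))"
      using b[of "Suc i"] step by simp
    finally show ?case using n3 by (simp add: zero_less_mult_iff)
  qed (use theta in simp)
  have "O_seq h" by (rule O_seqI) (use h0 macaulay_bound in \<open>simp_all add: h_def\<close>)
  moreover have "O_seq (\<lambda>i. if i = 0 then h 0 else h i - h (i - 1))"
  proof (rule O_seqI)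
    fix i :: nat assume i: "i \<ge> 1"
    \<comment> \<open>If \<open>L\<close> is injective in degree \<open>i\<close>, the difference is
      the dimension of the cokernel; if it is surjective, both sides are zero, the left one possibly
      by truncation.\<close>
    have J: "h (Suc i) - h i = hilb n (add_form n I L) (Suc i)" for i
      using hilb_add_form[OF L, of i] full_rank[of i] rank_le[OF L, of i] by (auto simp: h_def)
    obtain \<rho> where "graded_quotient n (add_form n I L) \<rho>"
      using exists_graded_quotient[OF hom_ideal_add_form[OF L]] by blast
    then interpret J: graded_quotient n "add_form n I L" \<rho> .
    obtain k where "i = Suc k" using i by (cases i) auto
    then show "(if Suc i = 0 then h 0 else h (Suc i) - h (Suc i - 1))
        \<le> mac_up i (if i = 0 then h 0 else h i - h (i - 1))"
      using J.macaulay_bound[OF i] J[of i] J[of k] by simp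
  qed (simp add: h0)
  ultimately show ?thesis
    using inc r_theta b strict dec before by (auto intro: antisym)
qed

end
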